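(* Let $M$ be an orientable $(2,3)$ sub-Riemannian manifold with sub-Riemannian structure $(\mathcal{H},\langle\cdot,\cdot\rangle)$, let $U\subseteq M$ be an open set on which $\mathcal{H}$ admits an ordered orthonormal frame, and let $p\in U$. Then there exists a Carnot frame for $\mathcal{H}$ at $p$ (on $U$).
   Context: A sub-Riemannian structure on a smooth manifold $M$ is a pair $(\mathcal{H},\langle\cdot,\cdot\rangle)$ with $\mathcal{H}$ a smooth sub-bundle of $TM$ and $\langle\cdot,\cdot\rangle$ a smooth fiber inner product on $\mathcal{H}$. A $(2,3)$ sub-Riemannian manifold is a smooth $3$-manifold with such a structure in which $\mathcal{H}$ has rank $2$ and, at every point, $\mathcal{H}$ together with brackets of local sections of $\mathcal{H}$ spans the tangent space. A Carnot frame for $\mathcal{H}$ at $p\in U$ is an ordered orthonormal frame $\{X_1,X_2\}$ of $\mathcal{H}$ on $U$ such that, with $X_3=[X_1,X_2]$, $[X_1,X_3]_p=0$ and $[X_2,X_3]_p=0$. *)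

theory Defs
  imports "HOL-Analysis.Analysis" "HOL-Library.Function_Algebras"
begin

instantiation "fun" :: (type, real_vector) real_vector
begin

definition scaleR_fun :: "real \<Rightarrow> ('a \<Rightarrow> 'b) \<Rightarrow> 'a \<Rightarrow> 'b"
  where "scaleR_fun c f = (\<lambda>x. c *\<^sub>R f x)"

instance
  by standard (simp_all add: scaleR_fun_def fun_eq_iff scaleR_add_right scaleR_add_left)

end

(* Only used for open S. *)
fun Ck_on :: "nat \<Rightarrow> 'a::real_normed_vector set \<Rightarrow> ('a \<Rightarrow> 'b::real_normed_vector) \<Rightarrow> bool" where
  "Ck_on 0 S f \<longleftrightarrow> continuous_on S f"
| "Ck_on (Suc k) S f \<longleftrightarrow>
     (\<forall>x\<in>S. f differentiable (at x)) \<and> (\<forall>v. Ck_on k S (\<lambda>x. frechet_derivative f (at x) v))"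

definition smooth_on :: "'a::real_normed_vector set \<Rightarrow> ('a \<Rightarrow> 'b::real_normed_vector) \<Rightarrow> bool"
  where "smooth_on S f \<longleftrightarrow> (\<forall>k. Ck_on k S f)"

type_synonym ('a, 'n) chart = "'a set \<times> ('a \<Rightarrow> real ^ 'n)"

definition is_chart :: "'a topology \<Rightarrow> ('a, 'n::finite) chart \<Rightarrow> bool" where
  "is_chart X = (\<lambda>(D, \<phi>). openin X D \<and> open (\<phi> ` D) \<and>
     homeomorphic_map (subtopology X D) (top_of_set (\<phi> ` D)) \<phi>)"

definition transition :: "('a, 'n::finite) chart \<Rightarrow> ('a, 'n) chart \<Rightarrow> real ^ 'n \<Rightarrow> real ^ 'n" where
  "transition c d = snd d \<circ> inv_into (fst c) (snd c)"

definition overlap :: "('a, 'n::finite) chart \<Rightarrow> ('a, 'n) chart \<Rightarrow> (real ^ 'n) set" where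
  "overlap c d = snd c ` (fst c \<inter> fst d)"

definition smooth_atlas :: "'a topology \<Rightarrow> ('a, 'n::finite) chart set \<Rightarrow> bool" where
  "smooth_atlas X A \<longleftrightarrow>
     (\<forall>c\<in>A. is_chart X c) \<and> (\<Union>c\<in>A. fst c) = topspace X \<and>
     (\<forall>c\<in>A. \<forall>d\<in>A. smooth_on (overlap c d) (transition c d))"

(* A tangent vector at p is a derivation on germs of smooth functions at p.  It is
   represented by a functional on all functions that vanishes on those not smooth near p,
   so that equality of functionals is equality of derivations. *)
type_synonym 'a tvec = "('a \<Rightarrow> real) \<Rightarrow> real"

(* The atlas A need not be maximal: it stands for the smooth structure it generates. *)
locale smooth_manifold =
  fixes X :: "'a topology" and A :: "('a, 'n::finite) chart set"
  assumes Hausdorff: "Hausdorff_space X"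
    and second_countable: "second_countable X"
    and atlas: "smooth_atlas X A"
begin

definition orientable :: bool where
  "orientable \<longleftrightarrow> (\<exists>B. smooth_atlas X B \<and> smooth_atlas X (A \<union> B) \<and>
     (\<forall>c\<in>B. \<forall>d\<in>B. \<forall>x\<in>overlap c d.
        det (matrix (frechet_derivative (transition c d) (at x))) > 0))"

definition smooth_fun :: "'a set \<Rightarrow> ('a \<Rightarrow> real) \<Rightarrow> bool" where
  "smooth_fun W f \<longleftrightarrow> openin X W \<and>
     (\<forall>(D, \<phi>)\<in>A. smooth_on (\<phi> ` (D \<inter> W)) (f \<circ> inv_into D \<phi>))"

definition smooth_near :: "'a \<Rightarrow> ('a \<Rightarrow> real) \<Rightarrow> bool" where
  "smooth_near p f \<longleftrightarrow> (\<exists>W. p \<in> W \<and> smooth_fun W f)"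

definition tangent_space :: "'a \<Rightarrow> 'a tvec set" where
  "tangent_space p = {v.
     (\<forall>f. \<not> smooth_near p f \<longrightarrow> v f = 0) \<and>
     (\<forall>W f g. openin X W \<and> p \<in> W \<and> (\<forall>q\<in>W. f q = g q) \<longrightarrow> v f = v g) \<and>
     (\<forall>f g. smooth_near p f \<and> smooth_near p g \<longrightarrow>
        v (\<lambda>q. f q + g q) = v f + v g \<and>
        v (\<lambda>q. f q * g q) = f p * v g + g p * v f) \<and>
     (\<forall>c f. smooth_near p f \<longrightarrow> v (\<lambda>q. c * f q) = c * v f)}"

definition smooth_vector_field :: "'a set \<Rightarrow> ('a \<Rightarrow> 'a tvec) \<Rightarrow> bool" where
  "smooth_vector_field W Y \<longleftrightarrow> openin X W \<and> (\<forall>q\<in>W. Y q \<in> tangent_space q) \<and>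
     (\<forall>V f. V \<subseteq> W \<and> smooth_fun V f \<longrightarrow> smooth_fun V (\<lambda>q. Y q f))"

(* The case distinction keeps the bracket a tangent vector in the above representation. *)
definition lie_bracket :: "('a \<Rightarrow> 'a tvec) \<Rightarrow> ('a \<Rightarrow> 'a tvec) \<Rightarrow> 'a \<Rightarrow> 'a tvec" where
  "lie_bracket Y Z q f =
     (if smooth_near q f then Y q (\<lambda>r. Z r f) - Z q (\<lambda>r. Y r f) else 0)"

definition smooth_section :: "('a \<Rightarrow> 'a tvec set) \<Rightarrow> 'a set \<Rightarrow> ('a \<Rightarrow> 'a tvec) \<Rightarrow> bool" where
  "smooth_section H W Y \<longleftrightarrow> smooth_vector_field W Y \<and> (\<forall>q\<in>W. Y q \<in> H q)"

definition smooth_subbundle :: "nat \<Rightarrow> ('a \<Rightarrow> 'a tvec set) \<Rightarrow> bool" where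
  "smooth_subbundle k H \<longleftrightarrow>
     (\<forall>q\<in>topspace X. subspace (H q) \<and> H q \<subseteq> tangent_space q) \<and>
     (\<forall>p\<in>topspace X. \<exists>W E. p \<in> W \<and> (\<forall>i<k. smooth_section H W (E i)) \<and> openin X W \<and>
        (\<forall>q\<in>W. inj_on (\<lambda>i. E i q) {..<k} \<and> independent ((\<lambda>i. E i q) ` {..<k}) \<and>
               span ((\<lambda>i. E i q) ` {..<k}) = H q))"

definition smooth_fiber_inner_product ::
    "('a \<Rightarrow> 'a tvec set) \<Rightarrow> ('a \<Rightarrow> 'a tvec \<Rightarrow> 'a tvec \<Rightarrow> real) \<Rightarrow> bool" where
  "smooth_fiber_inner_product H g \<longleftrightarrow>
     (\<forall>q\<in>topspace X. \<forall>u\<in>H q. \<forall>v\<in>H q.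
        g q u v = g q v u \<and>
        (\<forall>w\<in>H q. g q (u + v) w = g q u w + g q v w) \<and>
        (\<forall>c. g q (c *\<^sub>R u) v = c * g q u v) \<and>
        (u \<noteq> 0 \<longrightarrow> g q u u > 0)) \<and>
     (\<forall>W Y Z. smooth_section H W Y \<and> smooth_section H W Z \<longrightarrow>
        smooth_fun W (\<lambda>q. g q (Y q) (Z q)))"

end

locale sub_riemannian = smooth_manifold X A
  for X :: "'a topology" and A :: "('a, 'n::finite) chart set" +
  fixes k :: nat
    and H :: "'a \<Rightarrow> 'a tvec set"
    and g :: "'a \<Rightarrow> 'a tvec \<Rightarrow> 'a tvec \<Rightarrow> real"
  assumes subbundle: "smooth_subbundle k H"
    and inner_product: "smooth_fiber_inner_product H g"

(* Only first-order brackets are used: growth vector (2,3), not merely bracket generating. *)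
locale sub_riemannian_2_3 = sub_riemannian X A 2 H g
  for X :: "'a topology" and A :: "('a, 3) chart set" and H g +
  assumes spanning: "\<And>q. q \<in> topspace X \<Longrightarrow>
    span (H q \<union> {lie_bracket Y Z q | W Y Z. q \<in> W \<and> smooth_section H W Y \<and> smooth_section H W Z})
      = tangent_space q"
begin

definition orthonormal_frame :: "'a set \<Rightarrow> ('a \<Rightarrow> 'a tvec) \<Rightarrow> ('a \<Rightarrow> 'a tvec) \<Rightarrow> bool" where
  "orthonormal_frame U X1 X2 \<longleftrightarrow>
     smooth_section H U X1 \<and> smooth_section H U X2 \<and>
     (\<forall>q\<in>U. span {X1 q, X2 q} = H q \<and>
        g q (X1 q) (X1 q) = 1 \<and> g q (X2 q) (X2 q) = 1 \<and> g q (X1 q) (X2 q) = 0)"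

definition carnot_frame :: "'a set \<Rightarrow> 'a \<Rightarrow> ('a \<Rightarrow> 'a tvec) \<Rightarrow> ('a \<Rightarrow> 'a tvec) \<Rightarrow> bool" where
  "carnot_frame U p X1 X2 \<longleftrightarrow> p \<in> U \<and> orthonormal_frame U X1 X2 \<and>
     (let X3 = lie_bracket X1 X2 in lie_bracket X1 X3 p = 0 \<and> lie_bracket X2 X3 p = 0)"

end

end

theory Submission
  imports Defs
begin

text \<open>
  Rotate a given orthonormal frame \<open>Y1, Y2\<close> by an angle \<open>\<theta>\<close> with \<open>\<theta>(p) = 0\<close>.  With
  \<open>Y3 = [Y1, Y2]\<close>, the rotated frame has \<open>X3 = Y3 - (Y1 \<theta>) Y1 - (Y2 \<theta>) Y2\<close>, and at \<open>p\<close>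
  \<open>[X1, X3] = [Y1, Y3] - (Y1 Y1 \<theta>) Y1 - (Y1 Y2 \<theta> + X3 \<theta>) Y2 - (Y2 \<theta>) Y3\<close> and
  \<open>[X2, X3] = [Y2, Y3] - (Y2 Y1 \<theta> - X3 \<theta>) Y1 - (Y2 Y2 \<theta>) Y2 + (Y1 \<theta>) Y3\<close>.
  Since \<open>Y1, Y2, Y3\<close> is a basis of the tangent space, making both vanish prescribes the first
  derivatives of \<open>\<theta>\<close> at \<open>p\<close>, the pure second derivatives, and \<open>Y1 Y2 \<theta> + Y2 Y1 \<theta>\<close>; the one
  remaining equation, for \<open>Y1 Y2 \<theta> - Y2 Y1 \<theta> = Y3 \<theta>\<close>, determines \<open>Y3 \<theta>\<close>.  Such a 2-jet is
  realised by a quadratic polynomial in globally defined functions dual to \<open>Y1, Y2, Y3\<close> at \<open>p\<close>,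
  obtained by multiplying chart coordinates with a bump function.

  To avoid trigonometric functions the rotation is parametrised rationally,
  \<open>cos \<theta> = (1 - t\<^sup>2) / (1 + t\<^sup>2)\<close> and \<open>sin \<theta> = 2 t / (1 + t\<^sup>2)\<close>; tangent vectors are
  treated only as derivations, for which the Leibniz rule is then enough.
\<close>

subsection \<open>Functions of class \<open>C\<^sup>k\<close>\<close>

lemma Ck_on_imp_continuous_on: "Ck_on k S f \<Longrightarrow> continuous_on S f"
  by (cases k) (auto simp: continuous_at_imp_continuous_on differentiable_imp_continuous_within)

lemma Ck_on_SucD: "Ck_on (Suc k) S f \<Longrightarrow> Ck_on k S f"
proof (induction k arbitrary: f)
  case 0
  then show ?case using Ck_on_imp_continuous_on[of "Suc 0" S f] by simp
next
  case (Suc k)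
  then show ?case by (metis Ck_on.simps(2))
qed

lemma Ck_on_subset: "Ck_on k S f \<Longrightarrow> T \<subseteq> S \<Longrightarrow> Ck_on k T f"
  by (induction k arbitrary: f) (auto intro: continuous_on_subset)

lemma frechet_derivative_cong_open:
  assumes "open S" "x \<in> S" "\<And>y. y \<in> S \<Longrightarrow> f y = g y"
  shows "frechet_derivative f (at x) = frechet_derivative g (at x)"
proof -
  have "(f has_derivative D) (at x) \<longleftrightarrow> (g has_derivative D) (at x)" for D
    using assms has_derivative_transform_within_open[of f D x UNIV S g]
      has_derivative_transform_within_open[of g D x UNIV S f] by auto
  then show ?thesis by (simp add: frechet_derivative_def)
qed

lemma differentiable_cong_open:
  assumes "open S" "x \<in> S" "\<And>y. y \<in> S \<Longrightarrow> f y = g y" "f differentiable (at x)"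
  shows "g differentiable (at x)"
  using assms has_derivative_transform_within_open[of f _ x UNIV S g]
  unfolding differentiable_def by metis

lemma Ck_on_cong:
  assumes "open S" "\<And>x. x \<in> S \<Longrightarrow> f x = g x" "Ck_on k S f"
  shows "Ck_on k S g"
  using assms(2,3)
proof (induction k arbitrary: f g)
  case 0
  then show ?case by (simp cong: continuous_on_cong)
next
  case (Suc k)
  have "Ck_on k S (\<lambda>x. frechet_derivative g (at x) v)" for v
  proof (rule Suc.IH)
    show "Ck_on k S (\<lambda>x. frechet_derivative f (at x) v)" using Suc.prems(2) by simp
    show "frechet_derivative f (at x) v = frechet_derivative g (at x) v" if "x \<in> S" for x
      using frechet_derivative_cong_open[OF assms(1) that, of f g] Suc.prems(1) by simp
  qed
  moreover have "g differentiable (at x)" if "x \<in> S" for x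
    using differentiable_cong_open[OF assms(1) that, of f g] Suc.prems that by auto
  ultimately show ?case by simp
qed

lemma Ck_on_local:
  assumes "\<And>x. x \<in> S \<Longrightarrow> \<exists>T. open T \<and> x \<in> T \<and> Ck_on k T f"
  shows "Ck_on k S f"
  using assms
proof (induction k arbitrary: f)
  case 0
  then have "continuous (at x) f" if "x \<in> S" for x
    using that continuous_on_eq_continuous_at by fastforce
  then show ?case by (simp add: continuous_at_imp_continuous_on)
next
  case (Suc k)
  have "Ck_on k S (\<lambda>x. frechet_derivative f (at x) v)" for v
    by (rule Suc.IH) (use Suc.prems in fastforce)
  then show ?case using Suc.prems by fastforce
qed

lemma Ck_on_SucI:
  assumes "open S" "\<And>x. x \<in> S \<Longrightarrow> (f has_derivative f' x) (at x)"
    "\<And>v. Ck_on k S (\<lambda>x. f' x v)"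
  shows "Ck_on (Suc k) S f"
proof -
  have "Ck_on k S (\<lambda>x. frechet_derivative f (at x) v)" for v
    by (rule Ck_on_cong[OF assms(1) _ assms(3)[of v]])
      (use assms(2) in \<open>metis frechet_derivative_at\<close>)
  then show ?thesis using assms(2) by (auto simp: differentiable_def)
qed

lemma Ck_on_Suc_has_derivative:
  "Ck_on (Suc k) S f \<Longrightarrow> x \<in> S \<Longrightarrow> (f has_derivative frechet_derivative f (at x)) (at x)"
  by (simp add: frechet_derivative_works)

lemma Ck_on_Suc_frechet:
  "Ck_on (Suc k) S f \<Longrightarrow> Ck_on k S (\<lambda>x. frechet_derivative f (at x) v)"
  by simp

lemma Ck_on_const: "open S \<Longrightarrow> Ck_on k S (\<lambda>x. c)"
proof (induction k arbitrary: c)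
  case (Suc k)
  show ?case by (rule Ck_on_SucI[where f' = "\<lambda>_ _. 0"]) (use Suc in auto)
qed simp

lemma Ck_on_add:
  "open S \<Longrightarrow> Ck_on k S f \<Longrightarrow> Ck_on k S g \<Longrightarrow> Ck_on k S (\<lambda>x. f x + g x)"
proof (induction k arbitrary: f g)
  case (Suc k)
  show ?case
    by (rule Ck_on_SucI[OF Suc.prems(1)],
        rule has_derivative_add[OF Ck_on_Suc_has_derivative[OF Suc.prems(2)]
          Ck_on_Suc_has_derivative[OF Suc.prems(3)]], assumption, assumption)
      (intro Suc.IH Suc.prems(1) Ck_on_Suc_frechet[OF Suc.prems(2)] Ck_on_Suc_frechet[OF Suc.prems(3)])
qed (simp add: continuous_on_add)

lemma Ck_on_mult:
  fixes f g :: "_ \<Rightarrow> real"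
  shows "open S \<Longrightarrow> Ck_on k S f \<Longrightarrow> Ck_on k S g \<Longrightarrow> Ck_on k S (\<lambda>x. f x * g x)"
proof (induction k arbitrary: f g)
  case (Suc k)
  show ?case
    by (rule Ck_on_SucI[OF Suc.prems(1)],
        rule has_derivative_mult[OF Ck_on_Suc_has_derivative[OF Suc.prems(2)]
          Ck_on_Suc_has_derivative[OF Suc.prems(3)]], assumption, assumption)
      (intro Ck_on_add Suc.IH Suc.prems(1)
        Ck_on_Suc_frechet[OF Suc.prems(2)] Ck_on_Suc_frechet[OF Suc.prems(3)]
        Ck_on_SucD[OF Suc.prems(2)] Ck_on_SucD[OF Suc.prems(3)])
qed (simp add: continuous_on_mult)

lemma Ck_on_bounded_linear:
  assumes "bounded_linear L"
  shows "open S \<Longrightarrow> Ck_on k S f \<Longrightarrow> Ck_on k S (\<lambda>x. L (f x))"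
proof (induction k arbitrary: f)
  case (Suc k)
  show ?case
    by (rule Ck_on_SucI[OF Suc.prems(1)],
        rule bounded_linear.has_derivative[OF assms Ck_on_Suc_has_derivative[OF Suc.prems(2)]],
        assumption)
      (intro Suc.IH Suc.prems(1) Ck_on_Suc_frechet[OF Suc.prems(2)])
qed (simp add: bounded_linear.continuous_on[OF assms])

lemma Ck_on_inverse:
  fixes f :: "_ \<Rightarrow> real"
  assumes "open S" "\<And>x. x \<in> S \<Longrightarrow> f x \<noteq> 0"
  shows "Ck_on k S f \<Longrightarrow> Ck_on k S (\<lambda>x. inverse (f x))"
proof (induction k)
  case 0
  then show ?case using assms(2) by (auto intro: continuous_on_inverse)
next
  case (Suc k)
  have "Ck_on k S (\<lambda>x. (- 1) * (inverse (f x) * frechet_derivative f (at x) v * inverse (f x)))" for v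
    by (intro Ck_on_mult Ck_on_const assms(1) Suc.IH Ck_on_Suc_frechet[OF Suc.prems]
        Ck_on_SucD[OF Suc.prems])
  then have *: "Ck_on k S (\<lambda>x. - (inverse (f x) * frechet_derivative f (at x) v * inverse (f x)))" for v
    by (simp del: Ck_on.simps)
  show ?case
    by (rule Ck_on_SucI[OF assms(1)],
        rule Deriv.has_derivative_inverse[OF assms(2) Ck_on_Suc_has_derivative[OF Suc.prems]],
        assumption, assumption) (rule *)
qed

text \<open>
  These functions are closed under differentiation, and \<open>flat_fun 1\<close> is the bump profile
  \<open>exp (-1 / s)\<close>.
\<close>

definition flat_fun :: "real poly \<Rightarrow> real \<Rightarrow> real" where
  "flat_fun P s = (if s > 0 then poly P (inverse s) * exp (- inverse s) else 0)"

lemma poly_exp_minus_tendsto_0: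
  "((\<lambda>x::real. poly P x * exp (- x)) \<longlongrightarrow> 0) at_top"
proof -
  have "((\<lambda>x::real. x ^ i * exp (- x)) \<longlongrightarrow> 0) at_top" for i
    using tendsto_power_div_exp_0[of i] by (simp add: exp_minus divide_inverse)
  then have "((\<lambda>x::real. \<Sum>i\<le>degree P. coeff P i * (x ^ i * exp (- x))) \<longlongrightarrow> (\<Sum>i\<le>degree P. coeff P i * 0)) at_top"
    by (intro tendsto_sum tendsto_mult tendsto_const)
  then show ?thesis by (simp add: poly_altdef sum_distrib_right mult.assoc)
qed

lemma flat_fun_has_derivative_0: "(flat_fun P has_field_derivative 0) (at 0)"
proof -
  have "((\<lambda>s. flat_fun P s / s) \<longlongrightarrow> 0) (at_right 0)"
  proof -
    have "((\<lambda>s::real. poly (pCons 0 P) (inverse s) * exp (- inverse s)) \<longlongrightarrow> 0) (at_right 0)"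
      by (rule filterlim_compose[OF poly_exp_minus_tendsto_0 filterlim_inverse_at_top_right])
    moreover have "\<forall>\<^sub>F s in at_right 0. poly (pCons 0 P) (inverse s) * exp (- inverse s) = flat_fun P s / s"
      by (auto simp: eventually_at_filter flat_fun_def divide_inverse)
    ultimately show ?thesis by (rule Lim_transform_eventually)
  qed
  moreover have "((\<lambda>s. flat_fun P s / s) \<longlongrightarrow> 0) (at_left 0)"
    by (rule Lim_transform_eventually[OF tendsto_const])
      (auto simp: eventually_at_filter flat_fun_def)
  ultimately have "((\<lambda>s. flat_fun P s / s) \<longlongrightarrow> 0) (at 0)"
    using filterlim_split_at by blast
  then show ?thesis by (simp add: has_field_derivative_iff flat_fun_def)
qed

lemma flat_fun_has_derivative:
  "(flat_fun P has_field_derivative flat_fun ([:0, 0, 1:] * (P - pderiv P)) s) (at s)"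
proof -
  consider "s > 0" | "s = 0" | "s < 0" by linarith
  then show ?thesis
  proof cases
    case 1
    have "((\<lambda>s. poly P (inverse s) * exp (- inverse s)) has_field_derivative
        flat_fun ([:0, 0, 1:] * (P - pderiv P)) s) (at s)"
      using 1 by (auto intro!: derivative_eq_intros DERIV_chain2[OF poly_DERIV]
          simp: flat_fun_def algebra_simps power2_eq_square)
    then show ?thesis
      by (rule has_field_derivative_transform_within_open[where S = "{0<..}"])
        (use 1 in \<open>auto simp: flat_fun_def\<close>)
  next
    case 2
    then show ?thesis using flat_fun_has_derivative_0 by (simp add: flat_fun_def)
  next
    case 3
    have "((\<lambda>s. 0) has_field_derivative flat_fun ([:0, 0, 1:] * (P - pderiv P)) s) (at s)"
      using 3 by (simp add: flat_fun_def)
    then show ?thesis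
      by (rule has_field_derivative_transform_within_open[where S = "{..<0}"])
        (use 3 in \<open>auto simp: flat_fun_def\<close>)
  qed
qed

lemma Ck_on_flat_fun:
  assumes "open S"
  shows "Ck_on k S f \<Longrightarrow> Ck_on k S (\<lambda>x. flat_fun P (f x))"
proof (induction k arbitrary: P)
  case 0
  have "continuous_on UNIV (flat_fun P)"
    using DERIV_isCont[OF flat_fun_has_derivative] by (simp add: continuous_at_imp_continuous_on)
  then show ?case using 0 by (auto intro: continuous_on_compose2)
next
  case (Suc k)
  have *: "((\<lambda>x. flat_fun P (f x)) has_derivative
      (\<lambda>v. flat_fun ([:0, 0, 1:] * (P - pderiv P)) (f x) * frechet_derivative f (at x) v)) (at x)"
    if "x \<in> S" for x
    using has_derivative_compose[OF Ck_on_Suc_has_derivative[OF Suc.prems that]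
        flat_fun_has_derivative[of P "f x", unfolded has_field_derivative_def]] by simp
  show ?case
    by (rule Ck_on_SucI[OF assms *], assumption)
      (intro Ck_on_mult[OF assms] Suc.IH Ck_on_Suc_frechet[OF Suc.prems] Ck_on_SucD[OF Suc.prems])
qed

subsection \<open>Smooth functions and tangent vectors\<close>

context smooth_manifold
begin

lemma chartD:
  assumes "(D, \<phi>) \<in> A"
  shows "openin X D" "open (\<phi> ` D)" "inj_on \<phi> D"
    "homeomorphic_map (subtopology X D) (top_of_set (\<phi> ` D)) \<phi>"
proof -
  have c: "is_chart X (D, \<phi>)" using atlas assms by (auto simp: smooth_atlas_def)
  then show "openin X D" "open (\<phi> ` D)"
    and h: "homeomorphic_map (subtopology X D) (top_of_set (\<phi> ` D)) \<phi>"
    by (auto simp: is_chart_def)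
  have "topspace (subtopology X D) = D"
    using \<open>openin X D\<close> openin_subset by fastforce
  then show "inj_on \<phi> D"
    using homeomorphic_imp_injective_map[OF h] by simp
qed

lemma open_chart_image:
  assumes "(D, \<phi>) \<in> A" "openin X W"
  shows "open (\<phi> ` (D \<inter> W))"
proof -
  have "openin (subtopology X D) (D \<inter> W)"
    using assms(2) openin_subtopology_Int2 by blast
  then have "openin (top_of_set (\<phi> ` D)) (\<phi> ` (D \<inter> W))"
    using homeomorphic_imp_open_map[OF chartD(4)[OF assms(1)]] by (simp add: open_map_def)
  then show ?thesis using chartD(2)[OF assms(1)] openin_open_trans by blast
qed

lemma smooth_fun_iff:
  "smooth_fun W f \<longleftrightarrow> openin X W \<and>
     (\<forall>D \<phi> k. (D, \<phi>) \<in> A \<longrightarrow> Ck_on k (\<phi> ` (D \<inter> W)) (\<lambda>x. f (inv_into D \<phi> x)))"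
  unfolding smooth_fun_def smooth_on_def comp_def by auto

lemma smooth_funI:
  assumes "openin X W"
    "\<And>D \<phi> k. (D, \<phi>) \<in> A \<Longrightarrow> open (\<phi> ` (D \<inter> W)) \<Longrightarrow> Ck_on k (\<phi> ` (D \<inter> W)) (\<lambda>x. f (inv_into D \<phi> x))"
  shows "smooth_fun W f"
  using assms open_chart_image by (auto simp: smooth_fun_iff)

lemma smooth_fun_imp_openin: "smooth_fun W f \<Longrightarrow> openin X W"
  by (simp add: smooth_fun_iff)

lemma smooth_funD:
  "smooth_fun W f \<Longrightarrow> (D, \<phi>) \<in> A \<Longrightarrow> Ck_on k (\<phi> ` (D \<inter> W)) (\<lambda>x. f (inv_into D \<phi> x))"
  by (simp add: smooth_fun_iff)

lemma inv_into_chart_mem: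
  assumes "(D, \<phi>) \<in> A" "x \<in> \<phi> ` (D \<inter> W)"
  shows "inv_into D \<phi> x \<in> D \<inter> W"
  using assms chartD(3)[OF assms(1)] by auto

lemma smooth_fun_subset:
  assumes "smooth_fun W f" "openin X V" "V \<subseteq> W"
  shows "smooth_fun V f"
  by (rule smooth_funI[OF assms(2)], rule Ck_on_subset[OF smooth_funD[OF assms(1)]])
    (use assms(3) in auto)

lemma smooth_fun_cong:
  assumes "smooth_fun W f" "\<And>q. q \<in> W \<Longrightarrow> f q = h q"
  shows "smooth_fun W h"
proof (rule smooth_funI[OF smooth_fun_imp_openin[OF assms(1)]])
  fix D \<phi> k assume c: "(D, \<phi>) \<in> A" and o: "open (\<phi> ` (D \<inter> W))"
  show "Ck_on k (\<phi> ` (D \<inter> W)) (\<lambda>x. h (inv_into D \<phi> x))"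
    by (rule Ck_on_cong[OF o _ smooth_funD[OF assms(1) c]])
      (use assms(2) inv_into_chart_mem[OF c] in blast)
qed

lemma smooth_fun_local:
  assumes "openin X W" "\<And>q. q \<in> W \<Longrightarrow> \<exists>V. q \<in> V \<and> smooth_fun V f"
  shows "smooth_fun W f"
proof (rule smooth_funI[OF assms(1)], rule Ck_on_local)
  fix D \<phi> k x assume c: "(D, \<phi>) \<in> A" and "x \<in> \<phi> ` (D \<inter> W)"
  then obtain q where q: "q \<in> D" "q \<in> W" "x = \<phi> q" by blast
  with assms(2) obtain V where "q \<in> V" "smooth_fun V f" by blast
  then show "\<exists>T. open T \<and> x \<in> T \<and> Ck_on k T (\<lambda>x. f (inv_into D \<phi> x))"
    using q c by (intro exI[of _ "\<phi> ` (D \<inter> V)"])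
      (auto intro: open_chart_image smooth_funD smooth_fun_imp_openin)
qed

lemma smooth_fun_const: "openin X W \<Longrightarrow> smooth_fun W (\<lambda>_. c)"
  by (rule smooth_funI) (auto intro: Ck_on_const)

lemma smooth_fun_add: "smooth_fun W f \<Longrightarrow> smooth_fun W h \<Longrightarrow> smooth_fun W (\<lambda>q. f q + h q)"
  by (simp add: smooth_fun_iff Ck_on_add open_chart_image)

lemma smooth_fun_mult: "smooth_fun W f \<Longrightarrow> smooth_fun W h \<Longrightarrow> smooth_fun W (\<lambda>q. f q * h q)"
  by (simp add: smooth_fun_iff Ck_on_mult open_chart_image)

lemma smooth_fun_cmult: "smooth_fun W f \<Longrightarrow> smooth_fun W (\<lambda>q. c * f q)"
  by (intro smooth_fun_mult smooth_fun_const smooth_fun_imp_openin)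

lemma smooth_fun_uminus: "smooth_fun W f \<Longrightarrow> smooth_fun W (\<lambda>q. - f q)"
  using smooth_fun_cmult[of W f "-1"] by simp

lemma smooth_fun_diff: "smooth_fun W f \<Longrightarrow> smooth_fun W h \<Longrightarrow> smooth_fun W (\<lambda>q. f q - h q)"
  using smooth_fun_add[of W f "\<lambda>q. - h q"] smooth_fun_uminus[of W h] by simp

lemma smooth_fun_sum:
  assumes "openin X W" "\<And>i. i \<in> I \<Longrightarrow> smooth_fun W (f i)"
  shows "smooth_fun W (\<lambda>q. \<Sum>i\<in>I. f i q)"
  using assms(2)
  by (induction I rule: infinite_finite_induct)
    (auto intro: smooth_fun_const smooth_fun_add assms(1))

lemma smooth_fun_inverse:
  assumes "smooth_fun W f" "\<And>q. q \<in> W \<Longrightarrow> f q \<noteq> 0"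
  shows "smooth_fun W (\<lambda>q. inverse (f q))"
proof (rule smooth_funI[OF smooth_fun_imp_openin[OF assms(1)]])
  fix D \<phi> k assume c: "(D, \<phi>) \<in> A" and o: "open (\<phi> ` (D \<inter> W))"
  show "Ck_on k (\<phi> ` (D \<inter> W)) (\<lambda>x. inverse (f (inv_into D \<phi> x)))"
    by (rule Ck_on_inverse[OF o _ smooth_funD[OF assms(1) c]])
      (use assms(2) inv_into_chart_mem[OF c] in blast)
qed

lemma smooth_fun_flat_fun:
  assumes "smooth_fun W f"
  shows "smooth_fun W (\<lambda>q. flat_fun P (f q))"
  by (rule smooth_funI[OF smooth_fun_imp_openin[OF assms]])
    (rule Ck_on_flat_fun[OF _ smooth_funD[OF assms]])

lemma smooth_fun_coordinate:
  assumes "(D, \<phi>) \<in> A"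
  shows "smooth_fun D (\<lambda>q. \<phi> q $ i)"
proof (rule smooth_funI[OF chartD(1)[OF assms]])
  fix D' \<phi>' k assume c: "(D', \<phi>') \<in> A" and o: "open (\<phi>' ` (D' \<inter> D))"
  have "smooth_on (overlap (D', \<phi>') (D, \<phi>)) (transition (D', \<phi>') (D, \<phi>))"
    using atlas assms c unfolding smooth_atlas_def by blast
  then have "Ck_on k (\<phi>' ` (D' \<inter> D)) (\<lambda>x. \<phi> (inv_into D' \<phi>' x))"
    by (simp add: smooth_on_def overlap_def transition_def comp_def)
  then show "Ck_on k (\<phi>' ` (D' \<inter> D)) (\<lambda>x. \<phi> (inv_into D' \<phi>' x) $ i)"
    by (rule Ck_on_bounded_linear[OF bounded_linear_vec_nth o])
qed

lemma smooth_nearI: "smooth_fun W f \<Longrightarrow> p \<in> W \<Longrightarrow> smooth_near p f"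
  by (auto simp: smooth_near_def)

lemma tangent_cong:
  assumes "v \<in> tangent_space p" "openin X W" "p \<in> W" "\<And>q. q \<in> W \<Longrightarrow> f q = h q"
  shows "v f = v h"
  using assms unfolding tangent_space_def mem_Collect_eq by blast

lemma tangent_not_smooth: "v \<in> tangent_space p \<Longrightarrow> \<not> smooth_near p f \<Longrightarrow> v f = 0"
  unfolding tangent_space_def by blast

lemma tangent_add:
  assumes v: "v \<in> tangent_space p" and "p \<in> W" "smooth_fun W f" "smooth_fun W h"
  shows "v (\<lambda>q. f q + h q) = v f + v h"
  using v[unfolded tangent_space_def mem_Collect_eq, THEN conjunct2, THEN conjunct2, THEN conjunct1,
      rule_format, of f h] assms smooth_nearI by simp

lemma tangent_mult:
  assumes v: "v \<in> tangent_space p" and "p \<in> W" "smooth_fun W f" "smooth_fun W h"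
  shows "v (\<lambda>q. f q * h q) = f p * v h + h p * v f"
  using v[unfolded tangent_space_def mem_Collect_eq, THEN conjunct2, THEN conjunct2, THEN conjunct1,
      rule_format, of f h] assms smooth_nearI by simp

lemma tangent_cmult:
  assumes v: "v \<in> tangent_space p" and "p \<in> W" "smooth_fun W f"
  shows "v (\<lambda>q. c * f q) = c * v f"
  using v[unfolded tangent_space_def mem_Collect_eq, THEN conjunct2, THEN conjunct2, THEN conjunct2,
      rule_format, of f c] assms smooth_nearI by simp

lemma tangent_uminus:
  assumes "v \<in> tangent_space p" "p \<in> W" "smooth_fun W f"
  shows "v (\<lambda>q. - f q) = - v f"
  using tangent_cmult[OF assms, of "-1"] by simp

lemma tangent_diff:
  assumes "v \<in> tangent_space p" "p \<in> W" "smooth_fun W f" "smooth_fun W h"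
  shows "v (\<lambda>q. f q - h q) = v f - v h"
  using tangent_add[OF assms(1-3) smooth_fun_uminus[OF assms(4)]]
    tangent_uminus[OF assms(1,2,4)] by simp

lemma tangent_const:
  assumes "v \<in> tangent_space p" "p \<in> topspace X"
  shows "v (\<lambda>_. c) = 0"
proof -
  have o: "smooth_fun (topspace X) (\<lambda>_. d)" for d by (simp add: smooth_fun_const)
  have "v (\<lambda>_. 1 :: real) = 0"
    using tangent_mult[OF assms o[of 1] o[of 1]] by simp
  then show ?thesis using tangent_cmult[OF assms o[of 1], of c] by simp
qed

lemma tangent_sum:
  assumes "v \<in> tangent_space p" "p \<in> W" "openin X W" "\<And>i. i \<in> I \<Longrightarrow> smooth_fun W (f i)"
  shows "v (\<lambda>q. \<Sum>i\<in>I. f i q) = (\<Sum>i\<in>I. v (f i))"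
  using assms(4)
proof (induction I rule: infinite_finite_induct)
  case (insert i I)
  then show ?case using tangent_add[OF assms(1,2), of "f i" "\<lambda>q. \<Sum>i\<in>I. f i q"]
    by (simp add: smooth_fun_sum[OF assms(3)])
qed (use tangent_const[OF assms(1), of 0] assms(2) openin_subset[OF assms(3)] in auto)

lemma smooth_near_common:
  assumes "smooth_near p f" "smooth_near p h"
  obtains W where "p \<in> W" "smooth_fun W f" "smooth_fun W h"
proof -
  obtain V V' where V: "p \<in> V" "smooth_fun V f" "p \<in> V'" "smooth_fun V' h"
    using assms by (auto simp: smooth_near_def)
  then have o: "openin X (V \<inter> V')" by (simp add: smooth_fun_imp_openin openin_Int)
  then show thesis using V smooth_fun_subset[OF _ o] by (intro that[of "V \<inter> V'"]) auto
qed

lemma smooth_near_cong: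
  assumes "openin X W" "p \<in> W" "\<And>q. q \<in> W \<Longrightarrow> f q = h q" "smooth_near p f"
  shows "smooth_near p h"
proof -
  obtain V where V: "p \<in> V" "smooth_fun V f"
    using assms by (auto simp: smooth_near_def)
  then have o: "openin X (V \<inter> W)" using assms(1) by (simp add: smooth_fun_imp_openin openin_Int)
  have "smooth_fun (V \<inter> W) h"
    by (rule smooth_fun_cong[OF smooth_fun_subset[OF V(2) o]]) (use assms(3) in auto)
  then show ?thesis using V(1) assms(2) by (intro smooth_nearI[of "V \<inter> W"]) auto
qed

lemma tangent_spaceI:
  assumes not_smooth: "\<And>f. \<not> smooth_near p f \<Longrightarrow> v f = 0"
    and cong: "\<And>W f h. openin X W \<Longrightarrow> p \<in> W \<Longrightarrow> (\<And>q. q \<in> W \<Longrightarrow> f q = h q) \<Longrightarrow> v f = v h"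
    and add: "\<And>W f h. p \<in> W \<Longrightarrow> smooth_fun W f \<Longrightarrow> smooth_fun W h \<Longrightarrow>
      v (\<lambda>q. f q + h q) = v f + v h"
    and mult: "\<And>W f h. p \<in> W \<Longrightarrow> smooth_fun W f \<Longrightarrow> smooth_fun W h \<Longrightarrow>
      v (\<lambda>q. f q * h q) = f p * v h + h p * v f"
    and cmult: "\<And>W c f. p \<in> W \<Longrightarrow> smooth_fun W f \<Longrightarrow> v (\<lambda>q. c * f q) = c * v f"
  shows "v \<in> tangent_space p"
  unfolding tangent_space_def mem_Collect_eq
proof (intro conjI allI impI)
  fix f h assume "smooth_near p f \<and> smooth_near p h"
  then obtain W where "p \<in> W" "smooth_fun W f" "smooth_fun W h"
    using smooth_near_common by blast
  then show "v (\<lambda>q. f q + h q) = v f + v h" "v (\<lambda>q. f q * h q) = f p * v h + h p * v f"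
    by (rule add, rule mult)
next
  fix c f assume "smooth_near p f"
  then obtain W where "p \<in> W" "smooth_fun W f"
    unfolding smooth_near_def by blast
  then show "v (\<lambda>q. c * f q) = c * v f" by (rule cmult)
next
  fix W and f h :: "'a \<Rightarrow> real" assume "openin X W \<and> p \<in> W \<and> (\<forall>q\<in>W. f q = h q)"
  then show "v f = v h" using cong[of W f h] by simp
qed (rule not_smooth)

definition coordinate_vector :: "('a, 'n) chart \<Rightarrow> 'a \<Rightarrow> 'n \<Rightarrow> 'a tvec" where
  "coordinate_vector c p i f = (if smooth_near p f
     then frechet_derivative (\<lambda>x. f (inv_into (fst c) (snd c) x)) (at (snd c p)) (axis i 1) else 0)"

lemma smooth_near_differentiable:
  assumes "(D, \<phi>) \<in> A" "p \<in> D" "smooth_near p f"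
  shows "(\<lambda>x. f (inv_into D \<phi> x)) differentiable (at (\<phi> p))"
proof -
  obtain V where V: "p \<in> V" "smooth_fun V f" using assms by (auto simp: smooth_near_def)
  then show ?thesis using smooth_funD[OF V(2) assms(1), of "Suc 0"] assms(2) by auto
qed

lemma coordinate_vector_in_tangent_space:
  assumes c: "(D, \<phi>) \<in> A" and p: "p \<in> D"
  shows "coordinate_vector (D, \<phi>) p i \<in> tangent_space p"
proof -
  let ?v = "coordinate_vector (D, \<phi>) p i"
  have inv_p: "inv_into D \<phi> (\<phi> p) = p" using chartD(3)[OF c] p by simp
  have val: "?v f = f' (axis i 1)"
    if "smooth_near p f" "((\<lambda>x. f (inv_into D \<phi> x)) has_derivative f') (at (\<phi> p))" for f f'
    using that by (simp add: coordinate_vector_def frechet_derivative_at[symmetric])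
  have der: "((\<lambda>x. f (inv_into D \<phi> x)) has_derivative
      frechet_derivative (\<lambda>x. f (inv_into D \<phi> x)) (at (\<phi> p))) (at (\<phi> p))"
    if "smooth_near p f" for f
    using smooth_near_differentiable[OF c p that] by (simp add: frechet_derivative_works)
  show ?thesis
  proof (rule tangent_spaceI)
    fix W and f h :: "'a \<Rightarrow> real" assume W: "openin X W" "p \<in> W" "\<And>q. q \<in> W \<Longrightarrow> f q = h q"
    have "frechet_derivative (\<lambda>x. f (inv_into D \<phi> x)) (at (\<phi> p)) =
        frechet_derivative (\<lambda>x. h (inv_into D \<phi> x)) (at (\<phi> p))"
      by (rule frechet_derivative_cong_open[OF open_chart_image[OF c W(1)]])
        (use W p inv_into_chart_mem[OF c] in blast)+
    moreover have "smooth_near p f \<longleftrightarrow> smooth_near p h"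
      using smooth_near_cong[OF W(1,2), of f h] smooth_near_cong[OF W(1,2), of h f] W(3) by auto
    ultimately show "?v f = ?v h" by (simp add: coordinate_vector_def)
  next
    fix W f h assume W: "p \<in> W" "smooth_fun W f" "smooth_fun W h"
    have f: "smooth_near p f" and h: "smooth_near p h" using W smooth_nearI by auto
    show "?v (\<lambda>q. f q + h q) = ?v f + ?v h"
      using val[OF smooth_nearI[OF smooth_fun_add[OF W(2,3)] W(1)] has_derivative_add[OF der[OF f] der[OF h]]]
        val[OF f der[OF f]] val[OF h der[OF h]] by simp
    show "?v (\<lambda>q. f q * h q) = f p * ?v h + h p * ?v f"
      using val[OF smooth_nearI[OF smooth_fun_mult[OF W(2,3)] W(1)] has_derivative_mult[OF der[OF f] der[OF h]]]
        val[OF f der[OF f]] val[OF h der[OF h]] by (simp add: inv_p)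
  next
    fix W a f assume W: "p \<in> W" "smooth_fun W f"
    then have f: "smooth_near p f" using smooth_nearI by auto
    show "?v (\<lambda>q. a * f q) = a * ?v f"
      using val[OF smooth_nearI[OF smooth_fun_cmult[OF W(2)] W(1)] has_derivative_mult_right[OF der[OF f]]]
        val[OF f der[OF f]] by simp
  qed (simp add: coordinate_vector_def)
qed

lemma coordinate_vector_coordinate:
  assumes c: "(D, \<phi>) \<in> A" and p: "p \<in> D"
  shows "coordinate_vector (D, \<phi>) p i (\<lambda>q. \<phi> q $ j) = (if i = j then 1 else 0)"
proof -
  have "frechet_derivative (\<lambda>x. \<phi> (inv_into D \<phi> x) $ j) (at (\<phi> p)) =
      frechet_derivative (\<lambda>x. x $ j) (at (\<phi> p))"
    by (rule frechet_derivative_cong_open[OF chartD(2)[OF c]]) (use p in \<open>auto simp: f_inv_into_f\<close>)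
  also have "\<dots> = (\<lambda>x. x $ j)"
    using frechet_derivative_at[OF bounded_linear_imp_has_derivative[OF bounded_linear_vec_nth]] by metis
  finally show ?thesis
    using smooth_nearI[OF smooth_fun_coordinate[OF c] p]
    by (simp add: coordinate_vector_def axis_def)
qed

lemma chart_cball_closedin:
  assumes c: "(D, \<phi>) \<in> A" and K: "compact K" "K \<subseteq> \<phi> ` D"
  shows "closedin X (inv_into D \<phi> ` K)"
proof -
  obtain \<psi> where \<psi>: "homeomorphic_maps (subtopology X D) (top_of_set (\<phi> ` D)) \<phi> \<psi>"
    using chartD(4)[OF c] homeomorphic_map_maps by blast
  have top: "topspace (subtopology X D) = D"
    using chartD(1)[OF c] openin_subset by fastforce
  have "compactin (top_of_set (\<phi> ` D)) K"
    using K by (simp add: compactin_subtopology)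
  then have "compactin (subtopology X D) (\<psi> ` K)"
    using \<psi> image_compactin unfolding homeomorphic_maps_def by blast
  moreover have "\<psi> x = inv_into D \<phi> x" if "x \<in> K" for x
    using \<psi> K(2) that top chartD(3)[OF c] unfolding homeomorphic_maps_def
    by (metis imageE inv_into_f_f subsetD)
  then have "\<psi> ` K = inv_into D \<phi> ` K" by simp
  ultimately show ?thesis
    using Hausdorff compactin_imp_closedin by (auto simp: compactin_subtopology)
qed

lemma smooth_fun_extend_by_zero:
  assumes "smooth_fun D f" "closedin X K" "K \<subseteq> D" "\<And>q. q \<in> D - K \<Longrightarrow> f q = 0"
  shows "smooth_fun (topspace X) (\<lambda>q. if q \<in> D then f q else 0)"
proof (rule smooth_fun_local)
  fix q assume q: "q \<in> topspace X"
  have "smooth_fun D (\<lambda>q. if q \<in> D then f q else 0)"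
    by (rule smooth_fun_cong[OF assms(1)]) simp
  moreover have "smooth_fun (topspace X - K) (\<lambda>q. if q \<in> D then f q else 0)"
    by (rule smooth_fun_cong[OF smooth_fun_const[of _ 0]]) (use assms in auto)
  ultimately show "\<exists>V. q \<in> V \<and> smooth_fun V (\<lambda>q. if q \<in> D then f q else 0)"
    using q assms(3) by (cases "q \<in> D") (blast, intro exI[of _ "topspace X - K"], auto)
qed simp

lemma ex_global_coordinates:
  assumes "p \<in> topspace X"
  obtains e u where "\<And>i::'n. e i \<in> tangent_space p" "\<And>i::'n. smooth_fun (topspace X) (u i)"
    "\<And>i. u i p = 0" "\<And>i j. e i (u j) = (if i = j then 1 else 0)"
proof -
  obtain D \<phi> where c: "(D, \<phi>) \<in> A" and p: "p \<in> D"
    using atlas assms unfolding smooth_atlas_def by (metis UN_E prod.collapse)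
  have oD: "openin X D" using chartD(1)[OF c] .
  obtain r where r: "r > 0" "cball (\<phi> p) r \<subseteq> \<phi> ` D"
    using chartD(2)[OF c] p open_contains_cball by blast
  define y where "y i q = \<phi> q $ i - \<phi> p $ i" for i q
  define b where "b q = flat_fun 1 (r\<^sup>2 - (\<Sum>i\<in>UNIV. y i q * y i q)) * inverse (flat_fun 1 (r\<^sup>2))" for q
  define e where "e = coordinate_vector (D, \<phi>) p"
  define u where "u i q = (if q \<in> D then b q * y i q else 0)" for i q
  have y: "smooth_fun D (y i)" for i
    unfolding y_def by (intro smooth_fun_diff smooth_fun_coordinate c smooth_fun_const oD)
  have b: "smooth_fun D b"
    unfolding b_def
    by (intro smooth_fun_mult smooth_fun_flat_fun smooth_fun_diff smooth_fun_sum smooth_fun_const oD y)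
  have e: "e i \<in> tangent_space p" for i
    unfolding e_def by (rule coordinate_vector_in_tangent_space[OF c p])
  have yp: "y i p = 0" for i by (simp add: y_def)
  have "flat_fun 1 (r\<^sup>2) \<noteq> 0" using r by (simp add: flat_fun_def)
  then have bp: "b p = 1" by (simp add: b_def yp)
  define K where "K = inv_into D \<phi> ` cball (\<phi> p) r"
  have "smooth_fun (topspace X) (u i)" for i
    unfolding u_def
  proof (rule smooth_fun_extend_by_zero)
    show "smooth_fun D (\<lambda>q. b q * y i q)" by (intro smooth_fun_mult b y)
    show "closedin X K" unfolding K_def by (rule chart_cball_closedin[OF c compact_cball r(2)])
    show "K \<subseteq> D" unfolding K_def using r(2) by (auto intro: inv_into_into)
    fix q assume q: "q \<in> D - K"
    have "\<phi> q \<notin> cball (\<phi> p) r"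
    proof
      assume "\<phi> q \<in> cball (\<phi> p) r"
      then have "inv_into D \<phi> (\<phi> q) \<in> K" unfolding K_def by blast
      then show False using q chartD(3)[OF c] by simp
    qed
    then have "r < norm (\<phi> q - \<phi> p)" by (simp add: dist_norm norm_minus_commute)
    then have "r\<^sup>2 < (norm (\<phi> q - \<phi> p))\<^sup>2" using r(1) by (intro power_strict_mono) auto
    also have "\<dots> = (\<Sum>i\<in>UNIV. y i q * y i q)"
      unfolding power2_norm_eq_inner inner_vec_def y_def by simp
    finally show "b q * y i q = 0" by (simp add: b_def flat_fun_def)
  qed
  moreover have "e i (u j) = (if i = j then 1 else 0)" for i j
  proof -
    have "e i (u j) = e i (\<lambda>q. b q * y j q)"
      by (rule tangent_cong[OF e oD p]) (simp add: u_def)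
    also have "\<dots> = e i (y j)" using tangent_mult[OF e p b y] by (simp add: yp bp)
    also have "\<dots> = e i (\<lambda>q. \<phi> q $ j)"
      unfolding y_def using tangent_diff[OF e p smooth_fun_coordinate[OF c] smooth_fun_const[OF oD]]
        tangent_const[OF e assms] by simp
    finally show ?thesis unfolding e_def by (simp add: coordinate_vector_coordinate[OF c p])
  qed
  ultimately show thesis using e by (intro that[of e u]) (auto simp: u_def yp)
qed

end

subsection \<open>Vector fields and Lie brackets\<close>

context smooth_manifold
begin

lemma subspace_tangent_space:
  assumes "p \<in> topspace X"
  shows "subspace (tangent_space p)"
proof (rule subspaceI)
  show "0 \<in> tangent_space p" by (rule tangent_spaceI) simp_all
next
  fix v w assume v: "v \<in> tangent_space p" and w: "w \<in> tangent_space p"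
  show "v + w \<in> tangent_space p"
  proof (rule tangent_spaceI)
    fix W and f h :: "'a \<Rightarrow> real"
    assume W: "openin X W" "p \<in> W" "\<And>q. q \<in> W \<Longrightarrow> f q = h q"
    show "(v + w) f = (v + w) h" using tangent_cong[OF v W] tangent_cong[OF w W] by simp
  qed (simp_all add: tangent_not_smooth[OF v] tangent_not_smooth[OF w] tangent_add[OF v]
      tangent_add[OF w] tangent_mult[OF v] tangent_mult[OF w] tangent_cmult[OF v]
      tangent_cmult[OF w] algebra_simps)
next
  fix a v assume v: "v \<in> tangent_space p"
  show "a *\<^sub>R v \<in> tangent_space p"
  proof (rule tangent_spaceI)
    fix W and f h :: "'a \<Rightarrow> real"
    assume W: "openin X W" "p \<in> W" "\<And>q. q \<in> W \<Longrightarrow> f q = h q"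
    show "(a *\<^sub>R v) f = (a *\<^sub>R v) h" using tangent_cong[OF v W] by (simp add: scaleR_fun_def)
  qed (simp_all add: tangent_not_smooth[OF v] tangent_add[OF v] tangent_mult[OF v]
      tangent_cmult[OF v] scaleR_fun_def algebra_simps)
qed

lemma tangent_eqI:
  assumes "v \<in> tangent_space p" "w \<in> tangent_space p" "openin X U" "p \<in> U"
    "\<And>V f. p \<in> V \<Longrightarrow> V \<subseteq> U \<Longrightarrow> smooth_fun V f \<Longrightarrow> v f = w f"
  shows "v = w"
proof
  fix f
  show "v f = w f"
  proof (cases "smooth_near p f")
    case True
    then obtain V where V: "p \<in> V" "smooth_fun V f" by (auto simp: smooth_near_def)
    have "smooth_fun (V \<inter> U) f"
      by (rule smooth_fun_subset[OF V(2)]) (use V assms(3) in \<open>auto simp: smooth_fun_imp_openin\<close>)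
    then show ?thesis using assms(4,5) V(1) by blast
  qed (simp add: tangent_not_smooth[OF assms(1)] tangent_not_smooth[OF assms(2)])
qed

lemma field_tangent: "smooth_vector_field U Y \<Longrightarrow> q \<in> U \<Longrightarrow> Y q \<in> tangent_space q"
  by (simp add: smooth_vector_field_def)

lemma field_openin: "smooth_vector_field U Y \<Longrightarrow> openin X U"
  by (simp add: smooth_vector_field_def)

lemma field_smooth_fun:
  "smooth_vector_field U Y \<Longrightarrow> V \<subseteq> U \<Longrightarrow> smooth_fun V f \<Longrightarrow> smooth_fun V (\<lambda>q. Y q f)"
  unfolding smooth_vector_field_def by blast

lemma field_subset:
  "smooth_vector_field U Y \<Longrightarrow> openin X V \<Longrightarrow> V \<subseteq> U \<Longrightarrow> smooth_vector_field V Y"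
  unfolding smooth_vector_field_def by blast

lemma smooth_section_subset:
  "smooth_section H U Y \<Longrightarrow> openin X V \<Longrightarrow> V \<subseteq> U \<Longrightarrow> smooth_section H V Y"
  unfolding smooth_section_def using field_subset by blast

lemma field_add:
  assumes Y: "smooth_vector_field U Y" and Z: "smooth_vector_field U Z"
  shows "smooth_vector_field U (\<lambda>q. Y q + Z q)"
  unfolding smooth_vector_field_def
proof (intro conjI ballI allI impI)
  show "openin X U" using field_openin[OF Y] .
  fix q assume "q \<in> U"
  then show "Y q + Z q \<in> tangent_space q"
    using subspace_add[OF subspace_tangent_space] field_tangent[OF Y] field_tangent[OF Z]
      openin_subset[OF field_openin[OF Y]] by blast
next
  fix V f assume "V \<subseteq> U \<and> smooth_fun V f"
  then show "smooth_fun V (\<lambda>q. (Y q + Z q) f)"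
    using field_smooth_fun[OF Y] field_smooth_fun[OF Z] smooth_fun_add by simp
qed

lemma field_scale:
  assumes Y: "smooth_vector_field U Y" and a: "smooth_fun U a"
  shows "smooth_vector_field U (\<lambda>q. a q *\<^sub>R Y q)"
  unfolding smooth_vector_field_def
proof (intro conjI ballI allI impI)
  show "openin X U" using field_openin[OF Y] .
  fix q assume "q \<in> U"
  then show "a q *\<^sub>R Y q \<in> tangent_space q"
    using subspace_scale[OF subspace_tangent_space] field_tangent[OF Y]
      openin_subset[OF field_openin[OF Y]] by blast
next
  fix V f assume *: "V \<subseteq> U \<and> smooth_fun V f"
  then have "smooth_fun V a" using smooth_fun_subset[OF a] smooth_fun_imp_openin by blast
  then show "smooth_fun V (\<lambda>q. (a q *\<^sub>R Y q) f)"
    using * field_smooth_fun[OF Y] smooth_fun_mult by (simp add: scaleR_fun_def)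
qed

lemma second_derivative_add:
  assumes Y: "smooth_vector_field U Y" and Z: "smooth_vector_field U Z"
    and V: "q \<in> V" "V \<subseteq> U" and f: "smooth_fun V f" and h: "smooth_fun V h"
  shows "Y q (\<lambda>r. Z r (\<lambda>x. f x + h x)) = Y q (\<lambda>r. Z r f) + Y q (\<lambda>r. Z r h)"
proof -
  have Yq: "Y q \<in> tangent_space q" using field_tangent[OF Y] V by blast
  have "Z r (\<lambda>x. f x + h x) = Z r f + Z r h" if "r \<in> V" for r
    using tangent_add[OF field_tangent[OF Z] that f h] that V(2) by blast
  then have "Y q (\<lambda>r. Z r (\<lambda>x. f x + h x)) = Y q (\<lambda>r. Z r f + Z r h)"
    by (rule tangent_cong[OF Yq smooth_fun_imp_openin[OF f] V(1)])
  then show ?thesis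
    using tangent_add[OF Yq V(1) field_smooth_fun[OF Z V(2) f] field_smooth_fun[OF Z V(2) h]] by simp
qed

lemma second_derivative_mult:
  assumes Y: "smooth_vector_field U Y" and Z: "smooth_vector_field U Z"
    and V: "q \<in> V" "V \<subseteq> U" and f: "smooth_fun V f" and h: "smooth_fun V h"
  shows "Y q (\<lambda>r. Z r (\<lambda>x. f x * h x)) =
    f q * Y q (\<lambda>r. Z r h) + Z q h * Y q f + h q * Y q (\<lambda>r. Z r f) + Z q f * Y q h"
proof -
  have Yq: "Y q \<in> tangent_space q" using field_tangent[OF Y] V by blast
  note Zf = field_smooth_fun[OF Z V(2) f] and Zh = field_smooth_fun[OF Z V(2) h]
  have "Z r (\<lambda>x. f x * h x) = f r * Z r h + h r * Z r f" if "r \<in> V" for r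
    using tangent_mult[OF field_tangent[OF Z] that f h] that V(2) by blast
  then have "Y q (\<lambda>r. Z r (\<lambda>x. f x * h x)) = Y q (\<lambda>r. f r * Z r h + h r * Z r f)"
    by (rule tangent_cong[OF Yq smooth_fun_imp_openin[OF f] V(1)])
  then show ?thesis
    using tangent_add[OF Yq V(1) smooth_fun_mult[OF f Zh] smooth_fun_mult[OF h Zf]]
      tangent_mult[OF Yq V(1) f Zh] tangent_mult[OF Yq V(1) h Zf] by simp
qed

lemma second_derivative_cmult:
  assumes Y: "smooth_vector_field U Y" and Z: "smooth_vector_field U Z"
    and V: "q \<in> V" "V \<subseteq> U" and f: "smooth_fun V f"
  shows "Y q (\<lambda>r. Z r (\<lambda>x. a * f x)) = a * Y q (\<lambda>r. Z r f)"
proof -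
  have Yq: "Y q \<in> tangent_space q" using field_tangent[OF Y] V by blast
  have "Z r (\<lambda>x. a * f x) = a * Z r f" if "r \<in> V" for r
    using tangent_cmult[OF field_tangent[OF Z] that f] that V(2) by blast
  then have "Y q (\<lambda>r. Z r (\<lambda>x. a * f x)) = Y q (\<lambda>r. a * Z r f)"
    by (rule tangent_cong[OF Yq smooth_fun_imp_openin[OF f] V(1)])
  then show ?thesis using tangent_cmult[OF Yq V(1) field_smooth_fun[OF Z V(2) f]] by simp
qed

lemma lie_bracket_apply:
  "q \<in> V \<Longrightarrow> smooth_fun V f \<Longrightarrow> lie_bracket Y Z q f = Y q (\<lambda>r. Z r f) - Z q (\<lambda>r. Y r f)"
  by (auto simp: lie_bracket_def smooth_near_def)

lemma lie_bracket_antisym: "lie_bracket Z Y q = - lie_bracket Y Z q"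
  by (auto simp: lie_bracket_def fun_eq_iff)

lemma lie_bracket_self: "lie_bracket Y Y q = 0"
  by (auto simp: lie_bracket_def fun_eq_iff)

lemma smooth_fun_restrict:
  assumes "smooth_fun V f" "openin X U"
  shows "smooth_fun (V \<inter> U) f"
  by (rule smooth_fun_subset[OF assms(1)])
    (use assms smooth_fun_imp_openin in auto)

lemma lie_bracket_in_tangent_space:
  assumes Y: "smooth_vector_field U Y" and Z: "smooth_vector_field U Z" and q: "q \<in> U"
  shows "lie_bracket Y Z q \<in> tangent_space q"
proof (rule tangent_spaceI)
  fix W and f h :: "'a \<Rightarrow> real"
  assume W: "openin X W" "q \<in> W" "\<And>q. q \<in> W \<Longrightarrow> f q = h q"
  have o: "openin X (W \<inter> U)" using W(1) field_openin[OF Y] by blast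
  have *: "Y' r f = Y' r h" if "smooth_vector_field U Y'" "r \<in> W \<inter> U" for Y' r
    by (rule tangent_cong[OF field_tangent[OF that(1)] W(1)]) (use that(2) W(3) in auto)
  have "Y q (\<lambda>r. Z r f) = Y q (\<lambda>r. Z r h)"
    by (rule tangent_cong[OF field_tangent[OF Y q] o]) (use W q *[OF Z] in auto)
  moreover have "Z q (\<lambda>r. Y r f) = Z q (\<lambda>r. Y r h)"
    by (rule tangent_cong[OF field_tangent[OF Z q] o]) (use W q *[OF Y] in auto)
  moreover have "smooth_near q f \<longleftrightarrow> smooth_near q h"
    using smooth_near_cong[OF W(1,2), of f h] smooth_near_cong[OF W(1,2), of h f] W(3) by auto
  ultimately show "lie_bracket Y Z q f = lie_bracket Y Z q h" by (simp add: lie_bracket_def)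
next
  fix W f h assume "q \<in> W" and "smooth_fun W f" "smooth_fun W h"
  then have V: "q \<in> W \<inter> U" "W \<inter> U \<subseteq> U" and f: "smooth_fun (W \<inter> U) f" and h: "smooth_fun (W \<inter> U) h"
    using q smooth_fun_restrict field_openin[OF Y] by auto
  show "lie_bracket Y Z q (\<lambda>q. f q + h q) = lie_bracket Y Z q f + lie_bracket Y Z q h"
    using second_derivative_add[OF Y Z V f h] second_derivative_add[OF Z Y V f h]
    by (simp add: lie_bracket_apply[OF V(1)] f h smooth_fun_add)
  show "lie_bracket Y Z q (\<lambda>q. f q * h q) = f q * lie_bracket Y Z q h + h q * lie_bracket Y Z q f"
    using second_derivative_mult[OF Y Z V f h] second_derivative_mult[OF Z Y V f h]
    by (simp add: lie_bracket_apply[OF V(1)] f h smooth_fun_mult algebra_simps)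
next
  fix W a f assume "q \<in> W" and "smooth_fun W f"
  then have V: "q \<in> W \<inter> U" "W \<inter> U \<subseteq> U" and f: "smooth_fun (W \<inter> U) f"
    using q smooth_fun_restrict field_openin[OF Y] by auto
  show "lie_bracket Y Z q (\<lambda>q. a * f q) = a * lie_bracket Y Z q f"
    using second_derivative_cmult[OF Y Z V f] second_derivative_cmult[OF Z Y V f]
    by (simp add: lie_bracket_apply[OF V(1)] f smooth_fun_cmult algebra_simps)
qed (simp add: lie_bracket_def)

lemma field_lie_bracket:
  assumes Y: "smooth_vector_field U Y" and Z: "smooth_vector_field U Z"
  shows "smooth_vector_field U (lie_bracket Y Z)"
  unfolding smooth_vector_field_def
proof (intro conjI ballI allI impI)
  show "openin X U" using field_openin[OF Y] .
  show "lie_bracket Y Z q \<in> tangent_space q" if "q \<in> U" for q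
    using lie_bracket_in_tangent_space[OF Y Z that] .
next
  fix V f assume *: "V \<subseteq> U \<and> smooth_fun V f"
  have "smooth_fun V (\<lambda>q. Y q (\<lambda>r. Z r f) - Z q (\<lambda>r. Y r f))"
    using * field_smooth_fun[OF Y] field_smooth_fun[OF Z] smooth_fun_diff by simp
  then show "smooth_fun V (\<lambda>q. lie_bracket Y Z q f)"
    by (rule smooth_fun_cong) (use * in \<open>auto simp: lie_bracket_apply\<close>)
qed

lemma lie_bracket_cong:
  assumes Y: "smooth_vector_field U Y" and Z: "smooth_vector_field U Z" and q: "q \<in> U"
    and eq: "\<And>r. r \<in> U \<Longrightarrow> Y r = Y' r" "\<And>r. r \<in> U \<Longrightarrow> Z r = Z' r"
  shows "lie_bracket Y Z q = lie_bracket Y' Z' q"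
proof
  fix f
  have "Y q (\<lambda>r. Z r f) = Y q (\<lambda>r. Z' r f)"
    by (rule tangent_cong[OF field_tangent[OF Y q] field_openin[OF Y] q]) (simp add: eq)
  moreover have "Z q (\<lambda>r. Y r f) = Z q (\<lambda>r. Y' r f)"
    by (rule tangent_cong[OF field_tangent[OF Z q] field_openin[OF Z] q]) (simp add: eq)
  ultimately show "lie_bracket Y Z q f = lie_bracket Y' Z' q f"
    by (simp add: lie_bracket_def eq q)
qed

lemma lie_bracket_add_left:
  assumes Y: "smooth_vector_field U Y" and Z: "smooth_vector_field U Z"
    and W: "smooth_vector_field U W" and q: "q \<in> U"
  shows "lie_bracket (\<lambda>r. Y r + Z r) W q = lie_bracket Y W q + lie_bracket Z W q"
proof (rule tangent_eqI[where U = U])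
  show "lie_bracket (\<lambda>r. Y r + Z r) W q \<in> tangent_space q"
    by (rule lie_bracket_in_tangent_space[OF field_add[OF Y Z] W q])
  show "lie_bracket Y W q + lie_bracket Z W q \<in> tangent_space q"
    by (rule field_tangent[OF field_add[OF field_lie_bracket[OF Y W] field_lie_bracket[OF Z W]] q])
  fix V f assume V: "q \<in> V" "V \<subseteq> U" and f: "smooth_fun V f"
  have "W q (\<lambda>r. Y r f + Z r f) = W q (\<lambda>r. Y r f) + W q (\<lambda>r. Z r f)"
    using tangent_add[OF field_tangent[OF W q] V(1)] field_smooth_fun[OF Y V(2) f]
      field_smooth_fun[OF Z V(2) f] by simp
  then show "lie_bracket (\<lambda>r. Y r + Z r) W q f = (lie_bracket Y W q + lie_bracket Z W q) f"
    by (simp add: lie_bracket_apply[OF V(1) f])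
qed (use field_openin[OF Y] q in auto)

lemma lie_bracket_scale_left:
  assumes Y: "smooth_vector_field U Y" and a: "smooth_fun U a"
    and W: "smooth_vector_field U W" and q: "q \<in> U"
  shows "lie_bracket (\<lambda>r. a r *\<^sub>R Y r) W q = a q *\<^sub>R lie_bracket Y W q + (- W q a) *\<^sub>R Y q"
proof (rule tangent_eqI[where U = U])
  have "smooth_vector_field U (\<lambda>q. a q *\<^sub>R lie_bracket Y W q + (- W q a) *\<^sub>R Y q)"
    by (intro field_add field_scale field_lie_bracket Y W a smooth_fun_uminus field_smooth_fun[OF W]) simp
  then show "a q *\<^sub>R lie_bracket Y W q + (- W q a) *\<^sub>R Y q \<in> tangent_space q"
    using q by (rule field_tangent)
  show "lie_bracket (\<lambda>r. a r *\<^sub>R Y r) W q \<in> tangent_space q"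
    by (rule lie_bracket_in_tangent_space[OF field_scale[OF Y a] W q])
  fix V f assume V: "q \<in> V" "V \<subseteq> U" and f: "smooth_fun V f"
  have "W q (\<lambda>r. a r * Y r f) = a q * W q (\<lambda>r. Y r f) + Y q f * W q a"
    by (rule tangent_mult[OF field_tangent[OF W q] V(1)
          smooth_fun_subset[OF a smooth_fun_imp_openin[OF f] V(2)] field_smooth_fun[OF Y V(2) f]])
  then show "lie_bracket (\<lambda>r. a r *\<^sub>R Y r) W q f =
      (a q *\<^sub>R lie_bracket Y W q + (- W q a) *\<^sub>R Y q) f"
    by (simp add: lie_bracket_apply[OF V(1) f] scaleR_fun_def algebra_simps)
qed (use field_openin[OF Y] q in auto)

lemma lie_bracket_add_right:
  assumes Y: "smooth_vector_field U Y" and Z: "smooth_vector_field U Z"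
    and W: "smooth_vector_field U W" and q: "q \<in> U"
  shows "lie_bracket W (\<lambda>r. Y r + Z r) q = lie_bracket W Y q + lie_bracket W Z q"
  by (simp add: lie_bracket_antisym[of W "\<lambda>r. Y r + Z r"] lie_bracket_antisym[of W Y]
      lie_bracket_antisym[of W Z] lie_bracket_add_left[OF assms])

lemma lie_bracket_scale_right:
  assumes Y: "smooth_vector_field U Y" and a: "smooth_fun U a"
    and W: "smooth_vector_field U W" and q: "q \<in> U"
  shows "lie_bracket W (\<lambda>r. a r *\<^sub>R Y r) q = a q *\<^sub>R lie_bracket W Y q + W q a *\<^sub>R Y q"
  by (simp add: lie_bracket_antisym[of W "\<lambda>r. a r *\<^sub>R Y r"] lie_bracket_antisym[of W Y]
      lie_bracket_scale_left[OF assms])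

lemma lie_bracket_scale:
  assumes Y: "smooth_vector_field U Y" and a: "smooth_fun U a"
    and Z: "smooth_vector_field U Z" and b: "smooth_fun U b" and q: "q \<in> U"
  shows "lie_bracket (\<lambda>r. a r *\<^sub>R Y r) (\<lambda>r. b r *\<^sub>R Z r) q =
    (a q * b q) *\<^sub>R lie_bracket Y Z q + (a q * Y q b) *\<^sub>R Z q + (- (b q * Z q a)) *\<^sub>R Y q"
  unfolding lie_bracket_scale_left[OF Y a field_scale[OF Z b] q] lie_bracket_scale_right[OF Z b Y q]
  by (simp add: scaleR_fun_def fun_eq_iff algebra_simps)

lemma tangent_circle:
  assumes c: "smooth_fun U c" and s: "smooth_fun U s" and q: "q \<in> U"
    and cs: "\<And>r. r \<in> U \<Longrightarrow> c r * c r + s r * s r = 1" and v: "v \<in> tangent_space q"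
  shows "c q * v c + s q * v s = 0"
proof -
  have "v (\<lambda>r. c r * c r + s r * s r) = v (\<lambda>_. 1)"
    by (rule tangent_cong[OF v smooth_fun_imp_openin[OF c] q]) (rule cs)
  also have "\<dots> = 0"
    using tangent_const[OF v] openin_subset[OF smooth_fun_imp_openin[OF c]] q by blast
  finally show ?thesis
    using tangent_add[OF v q smooth_fun_mult[OF c c] smooth_fun_mult[OF s s]]
      tangent_mult[OF v q c c] tangent_mult[OF v q s s] by simp
qed

lemma lie_bracket_rotation:
  assumes Y1: "smooth_vector_field U Y1" and Y2: "smooth_vector_field U Y2"
    and c: "smooth_fun U c" and s: "smooth_fun U s"
    and cs: "\<And>r. r \<in> U \<Longrightarrow> c r * c r + s r * s r = 1" and q: "q \<in> U"
  shows "lie_bracket (\<lambda>r. c r *\<^sub>R Y1 r + s r *\<^sub>R Y2 r) (\<lambda>r. (- s r) *\<^sub>R Y1 r + c r *\<^sub>R Y2 r) q =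
    lie_bracket Y1 Y2 q + (- (c q * Y1 q s - s q * Y1 q c)) *\<^sub>R Y1 q
      + (- (c q * Y2 q s - s q * Y2 q c)) *\<^sub>R Y2 q"
proof -
  have ms: "smooth_fun U (\<lambda>r. - s r)" by (rule smooth_fun_uminus[OF s])
  note Y = field_scale[OF Y1 c] field_scale[OF Y2 s] field_scale[OF Y1 ms] field_scale[OF Y2 c]
  have "lie_bracket (\<lambda>r. c r *\<^sub>R Y1 r + s r *\<^sub>R Y2 r) (\<lambda>r. (- s r) *\<^sub>R Y1 r + c r *\<^sub>R Y2 r) q =
      (c q * c q + s q * s q) *\<^sub>R lie_bracket Y1 Y2 q
      + (- (c q * Y1 q s - s q * Y1 q c) - (c q * Y2 q c + s q * Y2 q s)) *\<^sub>R Y1 q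
      + (- (c q * Y2 q s - s q * Y2 q c) + (c q * Y1 q c + s q * Y1 q s)) *\<^sub>R Y2 q"
    unfolding lie_bracket_add_left[OF Y(1,2) field_add[OF Y(3,4)] q]
      lie_bracket_add_right[OF Y(3,4,1) q] lie_bracket_add_right[OF Y(3,4,2) q]
      lie_bracket_scale[OF Y1 c Y1 ms q] lie_bracket_scale[OF Y1 c Y2 c q]
      lie_bracket_scale[OF Y2 s Y1 ms q] lie_bracket_scale[OF Y2 s Y2 c q]
      tangent_uminus[OF field_tangent[OF Y1 q] q s] tangent_uminus[OF field_tangent[OF Y2 q] q s]
      lie_bracket_self lie_bracket_antisym[of Y2 Y1]
    by (simp add: scaleR_fun_def fun_eq_iff algebra_simps)
  then show ?thesis
    using tangent_circle[OF c s q cs field_tangent[OF Y1 q]]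
      tangent_circle[OF c s q cs field_tangent[OF Y2 q]] cs[OF q] by simp
qed

lemma tangent_space_subset_span_imp_dual_functions:
  fixes Y :: "'n \<Rightarrow> 'a tvec"
  assumes p: "p \<in> topspace X" and Y: "\<And>i. Y i \<in> tangent_space p"
    and span: "tangent_space p \<subseteq> span (range Y)"
  obtains u where "\<And>i. smooth_fun (topspace X) (u i)" "\<And>i. u i p = 0"
    "\<And>i j. Y j (u i) = (if i = j then 1 else 0)"
proof -
  obtain e x where e: "\<And>i::'n. e i \<in> tangent_space p"
    and x: "\<And>i::'n. smooth_fun (topspace X) (x i)" "\<And>i. x i p = 0"
    and ex: "\<And>i j. e i (x j) = (if i = j then 1 else 0)"
    by (rule ex_global_coordinates[OF p]) (rule that)
  have apply_sum: "(\<Sum>j\<in>J. c j *\<^sub>R Y j) f = (\<Sum>j\<in>J. c j * Y j f)" for c f J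
    by (induction J rule: infinite_finite_induct) (auto simp: scaleR_fun_def)
  define G where "G c = (\<Sum>j\<in>UNIV. c j *\<^sub>R Y j)" for c
  have "Y i = G (\<lambda>j. if j = i then 1 else 0)" for i
    by (simp add: G_def if_distrib[of "\<lambda>c. c *\<^sub>R _"] cong: if_cong)
  then have "range Y \<subseteq> range G" by blast
  moreover have "subspace (range G)"
  proof (rule subspaceI)
    have "0 = G (\<lambda>_. 0)" by (simp add: G_def)
    then show "0 \<in> range G" by blast
  next
    fix v w assume "v \<in> range G" "w \<in> range G"
    then obtain c d where "v = G c" "w = G d" by blast
    then have "v + w = G (\<lambda>j. c j + d j)" by (simp add: G_def scaleR_add_left sum.distrib)
    then show "v + w \<in> range G" by blast
  next
    fix a v assume "v \<in> range G"
    then obtain c where "v = G c" by blast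
    then have "a *\<^sub>R v = G (\<lambda>j. a * c j)" by (simp add: G_def scaleR_sum_right)
    then show "a *\<^sub>R v \<in> range G" by blast
  qed
  ultimately have "e i \<in> range G" for i
    using e span span_minimal by blast
  then have "\<exists>c. e i = (\<Sum>j\<in>UNIV. c j *\<^sub>R Y j)" for i unfolding G_def by blast
  then obtain N where N: "\<And>i. e i = (\<Sum>j\<in>UNIV. N i j *\<^sub>R Y j)" by metis
  have "(\<chi> i j. N i j) ** (\<chi> j k. Y j (x k)) = (mat 1 :: real^'n^'n)"
    using ex by (simp add: matrix_matrix_mult_def mat_def vec_eq_iff N apply_sum)
  then have "(\<chi> j k. Y j (x k)) ** (\<chi> i j. N i j) = (mat 1 :: real^'n^'n)"
    using matrix_left_right_inverse by blast
  then have inv: "(\<Sum>k\<in>UNIV. Y j (x k) * N k i) = (if j = i then 1 else 0)" for i j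
    by (simp add: matrix_matrix_mult_def mat_def vec_eq_iff)
  define u where "u i q = (\<Sum>k\<in>UNIV. N k i * x k q)" for i q
  have o: "openin X (topspace X)" by simp
  have "smooth_fun (topspace X) (u i)" for i
    unfolding u_def by (intro smooth_fun_sum smooth_fun_cmult x o)
  moreover have "Y j (u i) = (if i = j then 1 else 0)" for i j
  proof -
    have "Y j (u i) = (\<Sum>k\<in>UNIV. Y j (\<lambda>q. N k i * x k q))"
      unfolding u_def by (rule tangent_sum[OF Y p o]) (intro smooth_fun_cmult x)
    also have "\<dots> = (\<Sum>k\<in>UNIV. Y j (x k) * N k i)"
      by (simp add: tangent_cmult[OF Y p x(1)] mult.commute)
    finally show ?thesis using inv by auto
  qed
  ultimately show thesis by (intro that[of u]) (auto simp: u_def x)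
qed

text \<open>
  Here \<open>s\<close> plays the role of the angle: \<open>w Y = c (Y s) - s (Y c)\<close> is the derivative of the
  angle along \<open>Y\<close>, and the 2-jet of \<open>s\<close> at \<open>p\<close> equals that of the angle because \<open>s p = 0\<close>.
\<close>

lemma carnot_condition_of_rotation:
  fixes Y1 Y2 c s
  defines "Y3 \<equiv> lie_bracket Y1 Y2"
    and "X1 \<equiv> \<lambda>r. c r *\<^sub>R Y1 r + s r *\<^sub>R Y2 r"
    and "X2 \<equiv> \<lambda>r. (- s r) *\<^sub>R Y1 r + c r *\<^sub>R Y2 r"
  assumes Y1: "smooth_vector_field U Y1" and Y2: "smooth_vector_field U Y2"
    and c: "smooth_fun U c" and s: "smooth_fun U s"
    and cs: "\<And>r. r \<in> U \<Longrightarrow> c r * c r + s r * s r = 1" and p: "p \<in> U"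
    and cp: "c p = 1" and sp: "s p = 0"
    and a: "lie_bracket Y1 Y3 p = a1 *\<^sub>R Y1 p + a2 *\<^sub>R Y2 p + a3 *\<^sub>R Y3 p"
    and b: "lie_bracket Y2 Y3 p = b1 *\<^sub>R Y1 p + b2 *\<^sub>R Y2 p + b3 *\<^sub>R Y3 p"
    and s1: "Y1 p s = - b3" and s2: "Y2 p s = a3"
    and s3: "3 * Y3 p s = a2 - b1 + 2 * (a3 * a3 + b3 * b3)"
    and s11: "Y1 p (\<lambda>r. Y1 r s) = a1" and s22: "Y2 p (\<lambda>r. Y2 r s) = b2"
    and s12: "Y1 p (\<lambda>r. Y2 r s) + Y2 p (\<lambda>r. Y1 r s) = a2 + b1"
  shows "lie_bracket X1 (lie_bracket X1 X2) p = 0 \<and> lie_bracket X2 (lie_bracket X1 X2) p = 0"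
proof -
  define w where "w Y r = c r * Y r s - s r * Y r c" for Y :: "'a \<Rightarrow> 'a tvec" and r
  define X3 where "X3 = (\<lambda>r. Y3 r + (- w Y1 r) *\<^sub>R Y1 r + (- w Y2 r) *\<^sub>R Y2 r)"
  have ms: "smooth_fun U (\<lambda>r. - s r)" by (rule smooth_fun_uminus[OF s])
  have Y3: "smooth_vector_field U Y3" unfolding Y3_def by (rule field_lie_bracket[OF Y1 Y2])
  have X1: "smooth_vector_field U X1" and X2: "smooth_vector_field U X2"
    unfolding X1_def X2_def by (intro field_add field_scale Y1 Y2 c s ms)+
  have w: "smooth_fun U (\<lambda>r. - w Y r)" if "smooth_vector_field U Y" for Y
    unfolding w_def
    by (intro smooth_fun_uminus smooth_fun_diff smooth_fun_mult c s field_smooth_fun[OF that] order_refl)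
  note W = field_scale[OF Y1 w[OF Y1]] field_scale[OF Y2 w[OF Y2]]
  have X3: "smooth_vector_field U X3"
    unfolding X3_def by (rule field_add[OF field_add[OF Y3 W(1)] W(2)])
  have eq: "lie_bracket X1 X2 r = X3 r" if "r \<in> U" for r
    unfolding X1_def X2_def X3_def w_def Y3_def
    by (rule lie_bracket_rotation[OF Y1 Y2 c s cs that])
  have v_c: "v c = 0" if "v \<in> tangent_space p" for v
    using tangent_circle[OF c s p cs that] by (simp add: cp sp)
  have w_p: "w Y p = Y p s" for Y by (simp add: w_def cp sp)
  have Z_w: "Z p (\<lambda>r. - w Y r) = - Z p (\<lambda>r. Y r s)"
    if Y: "smooth_vector_field U Y" and Z: "smooth_vector_field U Z" for Y Z
  proof -
    have v: "Z p \<in> tangent_space p" using field_tangent[OF Z p] .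
    have sY: "smooth_fun U (\<lambda>r. Y r s)" and cY: "smooth_fun U (\<lambda>r. Y r c)"
      using field_smooth_fun[OF Y] s c by auto
    have "Z p (\<lambda>r. - w Y r) = - Z p (w Y)"
      unfolding w_def
      by (rule tangent_uminus[OF v p smooth_fun_diff[OF smooth_fun_mult[OF c sY] smooth_fun_mult[OF s cY]]])
    also have "Z p (w Y) = Z p (\<lambda>r. c r * Y r s) - Z p (\<lambda>r. s r * Y r c)"
      unfolding w_def
      by (rule tangent_diff[OF v p smooth_fun_mult[OF c sY] smooth_fun_mult[OF s cY]])
    also have "\<dots> = Z p (\<lambda>r. Y r s)"
      unfolding tangent_mult[OF v p c sY] tangent_mult[OF v p s cY]
      by (simp add: cp sp v_c[OF v] v_c[OF field_tangent[OF Y p]])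
    finally show ?thesis .
  qed
  have br: "lie_bracket Z X3 p = lie_bracket Z Y3 p
      + ((- Y1 p s) *\<^sub>R lie_bracket Z Y1 p + (- Z p (\<lambda>r. Y1 r s)) *\<^sub>R Y1 p)
      + ((- Y2 p s) *\<^sub>R lie_bracket Z Y2 p + (- Z p (\<lambda>r. Y2 r s)) *\<^sub>R Y2 p)"
    if Z: "smooth_vector_field U Z" for Z
    unfolding X3_def lie_bracket_add_right[OF field_add[OF Y3 W(1)] W(2) Z p]
      lie_bracket_add_right[OF Y3 W(1) Z p] lie_bracket_scale_right[OF Y1 w[OF Y1] Z p]
      lie_bracket_scale_right[OF Y2 w[OF Y2] Z p] w_p Z_w[OF Y1 Z] Z_w[OF Y2 Z] ..
  have X3_s: "X3 p s = Y3 p s - (a3 * a3 + b3 * b3)"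
    by (simp add: X3_def w_p scaleR_fun_def s1 s2)
  have Y3_s: "Y3 p s = Y1 p (\<lambda>r. Y2 r s) - Y2 p (\<lambda>r. Y1 r s)"
    unfolding Y3_def by (rule lie_bracket_apply[OF p s])
  obtain m12 m21 where m: "Y1 p (\<lambda>r. Y2 r s) = m12" "Y2 p (\<lambda>r. Y1 r s) = m21" by blast
  have eqs: "a2 - m12 - X3 p s = 0" "b1 - m21 + X3 p s = 0"
    using s3 s12 Y3_s X3_s unfolding m by (simp_all add: algebra_simps)
  have "X3 p (\<lambda>r. - s r) = - X3 p s" by (rule tangent_uminus[OF field_tangent[OF X3 p] p s])
  note vals = this cp sp v_c[OF field_tangent[OF X3 p]]
  have Y21: "lie_bracket Y2 Y1 p = - Y3 p" unfolding Y3_def by (rule lie_bracket_antisym)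
  have "lie_bracket X1 X3 p = lie_bracket Y1 X3 p + (- X3 p s) *\<^sub>R Y2 p"
    unfolding X1_def lie_bracket_add_left[OF field_scale[OF Y1 c] field_scale[OF Y2 s] X3 p]
      lie_bracket_scale_left[OF Y1 c X3 p] lie_bracket_scale_left[OF Y2 s X3 p]
    by (simp add: vals)
  also have "lie_bracket Y1 X3 p = a1 *\<^sub>R Y1 p + a2 *\<^sub>R Y2 p + a3 *\<^sub>R Y3 p
      + (- a1) *\<^sub>R Y1 p + ((- a3) *\<^sub>R Y3 p + (- Y1 p (\<lambda>r. Y2 r s)) *\<^sub>R Y2 p)"
    unfolding br[OF Y1] by (simp add: a s11 s2 lie_bracket_self Y3_def[symmetric])
  also have "\<dots> + (- X3 p s) *\<^sub>R Y2 p = (a2 - Y1 p (\<lambda>r. Y2 r s) - X3 p s) *\<^sub>R Y2 p"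
    by (simp add: scaleR_add_left scaleR_diff_left)
  also have "a2 - Y1 p (\<lambda>r. Y2 r s) - X3 p s = 0" unfolding m by (rule eqs)
  finally have 1: "lie_bracket X1 X3 p = 0" by (simp only: scaleR_zero_left)
  have "lie_bracket X2 X3 p = lie_bracket Y2 X3 p + X3 p s *\<^sub>R Y1 p"
    unfolding X2_def lie_bracket_add_left[OF field_scale[OF Y1 ms] field_scale[OF Y2 c] X3 p]
      lie_bracket_scale_left[OF Y1 ms X3 p] lie_bracket_scale_left[OF Y2 c X3 p]
    by (simp add: vals)
  also have "lie_bracket Y2 X3 p = b1 *\<^sub>R Y1 p + b2 *\<^sub>R Y2 p + b3 *\<^sub>R Y3 p
      + ((- b3) *\<^sub>R Y3 p + (- Y2 p (\<lambda>r. Y1 r s)) *\<^sub>R Y1 p) + (- b2) *\<^sub>R Y2 p"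
    unfolding br[OF Y2] by (simp add: b s22 s1 lie_bracket_self Y21)
  also have "\<dots> + X3 p s *\<^sub>R Y1 p = (b1 - Y2 p (\<lambda>r. Y1 r s) + X3 p s) *\<^sub>R Y1 p"
    by (simp add: scaleR_add_left scaleR_diff_left)
  also have "b1 - Y2 p (\<lambda>r. Y1 r s) + X3 p s = 0" unfolding m by (rule eqs)
  finally have 2: "lie_bracket X2 X3 p = 0" by (simp only: scaleR_zero_left)
  have "lie_bracket Z (lie_bracket X1 X2) p = lie_bracket Z X3 p"
    if "smooth_vector_field U Z" for Z
    by (rule lie_bracket_cong[OF that field_lie_bracket[OF X1 X2] p refl eq])
  with 1 2 X1 X2 show ?thesis by simp
qed

text \<open>Up to second order at \<open>p\<close>, \<open>s = 2 t / (1 + t\<^sup>2)\<close> agrees with \<open>2 t\<close>.\<close>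

lemma ex_circle_functions:
  assumes t: "smooth_fun (topspace X) t" and p: "p \<in> topspace X" and tp: "t p = 0"
  obtains c s where "smooth_fun (topspace X) c" "smooth_fun (topspace X) s"
    "\<And>r. c r * c r + s r * s r = 1" "c p = 1" "s p = 0"
    "\<And>v. v \<in> tangent_space p \<Longrightarrow> v s = 2 * v t"
    "\<And>U Y Z. smooth_vector_field U Y \<Longrightarrow> smooth_vector_field U Z \<Longrightarrow> p \<in> U \<Longrightarrow>
      Y p (\<lambda>r. Z r s) = 2 * Y p (\<lambda>r. Z r t)"
proof -
  define d where "d r = 1 + t r * t r" for r
  define h where "h r = inverse (d r)" for r
  define c where "c r = (1 - t r * t r) * h r" for r
  define s where "s r = (2 * t r) * h r" for r
  have d0: "d r \<noteq> 0" for r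
    using not_sum_power2_lt_zero[of 1 "t r"] by (simp add: d_def add_nonneg_eq_0_iff)
  have o: "openin X (topspace X)" by simp
  have d: "smooth_fun (topspace X) d"
    unfolding d_def by (intro smooth_fun_add smooth_fun_mult smooth_fun_const t o)
  have h: "smooth_fun (topspace X) h"
    unfolding h_def by (intro smooth_fun_inverse d d0)
  have t2: "smooth_fun (topspace X) (\<lambda>r. 2 * t r)" by (rule smooth_fun_cmult[OF t])
  have c: "smooth_fun (topspace X) c"
    unfolding c_def by (intro smooth_fun_diff smooth_fun_mult smooth_fun_const t h o)
  have s: "smooth_fun (topspace X) s"
    unfolding s_def by (intro smooth_fun_mult t2 h)
  have hp: "h p = 1" by (simp add: h_def d_def tp)
  have dp: "d p = 1" by (simp add: d_def tp)
  have circle: "c r * c r + s r * s r = 1" for r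
  proof -
    have "c r * c r + s r * s r = (d r * h r) * (d r * h r)"
      by (simp add: c_def s_def d_def algebra_simps)
    then show ?thesis using d0[of r] by (simp add: h_def)
  qed
  have cp: "c p = 1" and sp: "s p = 0" by (simp_all add: c_def s_def hp tp)
  have v_h: "v h = 0" if v: "v \<in> tangent_space p" for v
  proof -
    have "v (\<lambda>r. d r * h r) = v (\<lambda>_. 1)"
      by (rule tangent_cong[OF v o p]) (simp add: h_def d0)
    then have "v h + v d = 0"
      using tangent_mult[OF v p d h] tangent_const[OF v p] by (simp add: hp dp)
    moreover have "v d = 0"
      unfolding d_def
      using tangent_add[OF v p smooth_fun_const[OF o] smooth_fun_mult[OF t t]]
        tangent_mult[OF v p t t] tangent_const[OF v p] by (simp add: tp)
    ultimately show ?thesis by simp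
  qed
  have v_s: "v s = 2 * v t" if v: "v \<in> tangent_space p" for v
    unfolding s_def using tangent_mult[OF v p t2 h] tangent_cmult[OF v p t] by (simp add: hp tp)
  have "Y p (\<lambda>r. Z r s) = 2 * Y p (\<lambda>r. Z r t)"
    if Y: "smooth_vector_field U Y" and Z: "smooth_vector_field U Z" and pU: "p \<in> U" for U Y Z
  proof -
    note o' = field_openin[OF Y] and sub = openin_subset[OF field_openin[OF Y]]
    note r = smooth_fun_subset[OF _ o' sub]
    show ?thesis
      unfolding s_def
      using second_derivative_mult[OF Y Z pU order_refl r[OF t2] r[OF h]]
        second_derivative_cmult[OF Y Z pU order_refl r[OF t], of 2]
        v_h[OF field_tangent[OF Y pU]] v_h[OF field_tangent[OF Z pU]] by (simp add: hp tp)
  qed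
  then show thesis
    using that[OF c s circle _ _ v_s] cp sp by blast
qed

end

subsection \<open>Existence of Carnot frames\<close>

context sub_riemannian_2_3
begin

lemma ex_function_with_2jet:
  assumes Y1: "smooth_vector_field U Y1" and Y2: "smooth_vector_field U Y2" and p: "p \<in> U"
    and Y3: "Y3 \<in> tangent_space p" and span: "tangent_space p \<subseteq> span {Y1 p, Y2 p, Y3}"
  obtains t where "smooth_fun (topspace X) t" "t p = 0"
    "Y1 p t = l1" "Y2 p t = l2" "Y3 t = l3"
    "Y1 p (\<lambda>r. Y1 r t) = m11" "Y2 p (\<lambda>r. Y2 r t) = m22"
    "Y1 p (\<lambda>r. Y2 r t) + Y2 p (\<lambda>r. Y1 r t) = m12"
proof -
  have sub: "U \<subseteq> topspace X" using openin_subset[OF field_openin[OF Y1]] .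
  then have pX: "p \<in> topspace X" using p by blast
  have o: "openin X (topspace X)" by simp
  define Y where "Y i = (if i = 1 then Y1 p else if i = 2 then Y2 p else Y3)" for i :: 3
  have Y: "Y 1 = Y1 p" "Y 2 = Y2 p" "Y 3 = Y3" by (auto simp: Y_def)
  have "range Y = {Y1 p, Y2 p, Y3}" by (simp add: UNIV_3 Y)
  moreover have Y_tangent: "Y i \<in> tangent_space p" for i
    using field_tangent[OF Y1 p] field_tangent[OF Y2 p] Y3 by (simp add: Y_def)
  ultimately obtain u where u: "\<And>i. smooth_fun (topspace X) (u i)" and up: "\<And>i. u i p = 0"
    and Yu: "\<And>i j. Y j (u i) = (if i = j then 1 else 0)"
    using tangent_space_subset_span_imp_dual_functions[of p Y] pX span by metis
  have 1: "Y1 p (u i) = (if i = 1 then 1 else 0)" "Y2 p (u i) = (if i = 2 then 1 else 0)"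
    "Y3 (u i) = (if i = 3 then 1 else 0)" for i
    using Yu[of 1 i] Yu[of 2 i] Yu[of 3 i] by (auto simp: Y)
  define t0 where "t0 r = l1 * u 1 r + l2 * u 2 r + l3 * u 3 r" for r
  obtain m11' m12' m21' m22' where m': "Y1 p (\<lambda>r. Y1 r t0) = m11'" "Y1 p (\<lambda>r. Y2 r t0) = m12'"
    "Y2 p (\<lambda>r. Y1 r t0) = m21'" "Y2 p (\<lambda>r. Y2 r t0) = m22'" by blast
  define q11 where "q11 = (m11 - m11') / 2"
  define q22 where "q22 = (m22 - m22') / 2"
  define q12 where "q12 = (m12 - (m12' + m21')) / 2"
  define t where "t r = t0 r + (q11 * (u 1 r * u 1 r) + (q22 * (u 2 r * u 2 r) + q12 * (u 1 r * u 2 r)))" for r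
  have t0: "smooth_fun (topspace X) t0"
    unfolding t0_def by (intro smooth_fun_add smooth_fun_cmult u)
  have uu: "smooth_fun (topspace X) (\<lambda>r. u i r * u j r)" for i j by (intro smooth_fun_mult u)
  note quu = smooth_fun_cmult[OF uu]
  note qs = smooth_fun_add[OF quu smooth_fun_add[OF quu quu]]
  have t: "smooth_fun (topspace X) t"
    unfolding t_def by (rule smooth_fun_add[OF t0 qs])
  have v_t: "v t = l1 * v (u 1) + l2 * v (u 2) + l3 * v (u 3)" if v: "v \<in> tangent_space p" for v
  proof -
    note lu = smooth_fun_cmult[OF u]
    have "v t = v t0"
      unfolding t_def tangent_add[OF v pX t0 qs] tangent_add[OF v pX quu smooth_fun_add[OF quu quu]]
        tangent_add[OF v pX quu quu] tangent_cmult[OF v pX uu] tangent_mult[OF v pX u u]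
      by (simp add: up)
    then show ?thesis
      unfolding t0_def tangent_add[OF v pX smooth_fun_add[OF lu lu] lu] tangent_add[OF v pX lu lu]
        tangent_cmult[OF v pX u] .
  qed
  have ZZ_t: "Z p (\<lambda>r. Z' r t) = Z p (\<lambda>r. Z' r t0) + 2 * q11 * (Z p (u 1) * Z' p (u 1))
      + 2 * q22 * (Z p (u 2) * Z' p (u 2)) + q12 * (Z p (u 1) * Z' p (u 2) + Z p (u 2) * Z' p (u 1))"
    if Z: "smooth_vector_field U Z" and Z': "smooth_vector_field U Z'" for Z Z'
  proof -
    note r = smooth_fun_subset[OF _ field_openin[OF Y1] sub]
    note d = Z Z' p order_refl
    show ?thesis
      unfolding t_def second_derivative_add[OF d r[OF t0] r[OF qs]]
        second_derivative_add[OF d r[OF quu] r[OF smooth_fun_add[OF quu quu]]]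
        second_derivative_add[OF d r[OF quu] r[OF quu]]
        second_derivative_cmult[OF d r[OF uu]] second_derivative_mult[OF d r[OF u] r[OF u]]
      by (simp add: up algebra_simps)
  qed
  show thesis
    by (rule that[of t])
      (simp_all add: t t_def[of p] t0_def[of p] up v_t[OF field_tangent[OF Y1 p]] v_t[OF field_tangent[OF Y2 p]]
        v_t[OF Y3] ZZ_t[OF Y1 Y1] ZZ_t[OF Y1 Y2] ZZ_t[OF Y2 Y1] ZZ_t[OF Y2 Y2] 1 m' q11_def q22_def q12_def field_simps)
qed

lemma subspace_H: "q \<in> topspace X \<Longrightarrow> subspace (H q)"
  using subbundle by (auto simp: smooth_subbundle_def)

lemma inner_combination_left:
  assumes q: "q \<in> topspace X" and "u \<in> H q" "v \<in> H q" "w \<in> H q"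
  shows "g q (a *\<^sub>R u + b *\<^sub>R v) w = a * g q u w + b * g q v w"
proof -
  have "a *\<^sub>R u \<in> H q" "b *\<^sub>R v \<in> H q" using subspace_scale[OF subspace_H[OF q]] assms by auto
  moreover have "g q (x + y) w = g q x w + g q y w" if "x \<in> H q" "y \<in> H q" for x y
    using inner_product q assms(4) that unfolding smooth_fiber_inner_product_def by blast
  moreover have "g q (d *\<^sub>R x) w = d * g q x w" if "x \<in> H q" for d x
    using inner_product q assms(4) that unfolding smooth_fiber_inner_product_def by blast
  ultimately show ?thesis using assms by simp
qed

lemma inner_sym:
  assumes "q \<in> topspace X" "u \<in> H q" "v \<in> H q"
  shows "g q u v = g q v u"
  using inner_product assms unfolding smooth_fiber_inner_product_def by blast

lemma inner_combination:
  assumes q: "q \<in> topspace X" and u: "u \<in> H q" and v: "v \<in> H q"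
  shows "g q (a *\<^sub>R u + b *\<^sub>R v) (a' *\<^sub>R u + b' *\<^sub>R v) =
    a * a' * g q u u + (a * b' + b * a') * g q u v + b * b' * g q v v"
proof -
  have w: "x *\<^sub>R u + y *\<^sub>R v \<in> H q" for x y
    using subspace_H[OF q] u v by (simp add: subspace_add subspace_scale)
  show ?thesis
    unfolding inner_combination_left[OF q u v w] inner_sym[OF q u w] inner_sym[OF q v w]
      inner_combination_left[OF q u v u] inner_combination_left[OF q u v v] inner_sym[OF q v u]
    by (simp add: algebra_simps)
qed

lemma orthonormal_expansion:
  assumes q: "q \<in> topspace X" and H: "span {u, v} = H q"
    and uu: "g q u u = 1" and vv: "g q v v = 1" and uv: "g q u v = 0" and w: "w \<in> H q"
  shows "w = g q w u *\<^sub>R u + g q w v *\<^sub>R v"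
proof -
  have u: "u \<in> H q" and v: "v \<in> H q" using H span_base[of _ "{u, v}"] by auto
  obtain a b where ab: "w = a *\<^sub>R u + b *\<^sub>R v"
  proof -
    obtain a where "w - a *\<^sub>R u \<in> span {v}" using w H span_breakdown_eq by metis
    then obtain b where "w - a *\<^sub>R u = b *\<^sub>R v" using span_singleton by auto
    then show thesis using that[of a b] by (simp add: algebra_simps)
  qed
  show ?thesis
    unfolding ab inner_combination_left[OF q u v u] inner_combination_left[OF q u v v]
      inner_sym[OF q v u] by (simp add: uu vv uv)
qed

lemma orthonormal_frame_span_tangent_space:
  assumes fr: "orthonormal_frame U Y1 Y2" and p: "p \<in> U"
  shows "tangent_space p \<subseteq> span {Y1 p, Y2 p, lie_bracket Y1 Y2 p}" (is "_ \<subseteq> ?S")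
proof -
  have S1: "smooth_section H U Y1" and S2: "smooth_section H U Y2"
    using fr by (auto simp: orthonormal_frame_def)
  then have Y1: "smooth_vector_field U Y1" and Y2: "smooth_vector_field U Y2"
    by (auto simp: smooth_section_def)
  have sub: "U \<subseteq> topspace X" using openin_subset[OF field_openin[OF Y1]] .
  have base: "Y1 p \<in> ?S" "Y2 p \<in> ?S" "lie_bracket Y1 Y2 p \<in> ?S"
    by (simp_all add: span_base)
  have "H p \<subseteq> ?S"
    using fr p span_mono[of "{Y1 p, Y2 p}" "{Y1 p, Y2 p, lie_bracket Y1 Y2 p}"]
    by (auto simp: orthonormal_frame_def)
  moreover have "lie_bracket Y Z p \<in> ?S"
    if pW: "p \<in> W" and Y: "smooth_section H W Y" and Z: "smooth_section H W Z" for W Y Z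
  proof -
    define V where "V = W \<inter> U"
    have pV: "p \<in> V" using p pW by (simp add: V_def)
    have oV: "openin X V"
      using Y field_openin[OF Y1] by (auto simp: V_def smooth_section_def smooth_vector_field_def)
    have r: "smooth_section H V Y" "smooth_section H V Z" "smooth_section H V Y1" "smooth_section H V Y2"
      using Y Z S1 S2 smooth_section_subset[OF _ oV] unfolding V_def by auto
    then have f: "smooth_vector_field V Y" "smooth_vector_field V Z" "smooth_vector_field V Y1"
        "smooth_vector_field V Y2"
      by (simp_all add: smooth_section_def)
    have smooth_g: "smooth_fun V (\<lambda>q. g q (Y q) (Z q))"
      if "smooth_section H V Y" "smooth_section H V Z" for Y Z
      using inner_product[unfolded smooth_fiber_inner_product_def, THEN conjunct2, rule_format] that
      by simp
    have expand: "Y q = g q (Y q) (Y1 q) *\<^sub>R Y1 q + g q (Y q) (Y2 q) *\<^sub>R Y2 q"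
      if "smooth_section H V Y" "q \<in> V" for Y q
      by (rule orthonormal_expansion)
        (use that fr sub in \<open>auto simp: V_def orthonormal_frame_def smooth_section_def\<close>)
    have eq: "lie_bracket Y Z p =
      lie_bracket (\<lambda>q. g q (Y q) (Y1 q) *\<^sub>R Y1 q + g q (Y q) (Y2 q) *\<^sub>R Y2 q)
        (\<lambda>q. g q (Z q) (Y1 q) *\<^sub>R Y1 q + g q (Z q) (Y2 q) *\<^sub>R Y2 q) p"
      by (rule lie_bracket_cong[OF f(1,2) pV expand[OF r(1)] expand[OF r(2)]])
    note a = smooth_g[OF r(1,3)] smooth_g[OF r(1,4)] smooth_g[OF r(2,3)] smooth_g[OF r(2,4)]
    note F = field_scale[OF f(3) a(1)] field_scale[OF f(4) a(2)] field_scale[OF f(3) a(3)]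
      field_scale[OF f(4) a(4)]
    show ?thesis
      unfolding eq lie_bracket_add_left[OF F(1,2) field_add[OF F(3,4)] pV]
        lie_bracket_add_right[OF F(3,4,1) pV] lie_bracket_add_right[OF F(3,4,2) pV]
        lie_bracket_scale[OF f(3) a(1) f(3) a(3) pV] lie_bracket_scale[OF f(3) a(1) f(4) a(4) pV]
        lie_bracket_scale[OF f(4) a(2) f(3) a(3) pV] lie_bracket_scale[OF f(4) a(2) f(4) a(4) pV]
        lie_bracket_self lie_bracket_antisym[of Y2 Y1]
      by (intro span_add span_scale span_neg span_zero base)
  qed
  ultimately have "H p \<union> {lie_bracket Y Z p | W Y Z. p \<in> W \<and> smooth_section H W Y \<and> smooth_section H W Z} \<subseteq> ?S"
    by blast
  then show ?thesis using spanning[of p] span_minimal[OF _ subspace_span] p sub by blast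
qed

lemma orthonormal_frame_rotation:
  assumes fr: "orthonormal_frame U Y1 Y2" and c: "smooth_fun U c" and s: "smooth_fun U s"
    and cs: "\<And>r. r \<in> U \<Longrightarrow> c r * c r + s r * s r = 1"
  shows "orthonormal_frame U (\<lambda>r. c r *\<^sub>R Y1 r + s r *\<^sub>R Y2 r) (\<lambda>r. (- s r) *\<^sub>R Y1 r + c r *\<^sub>R Y2 r)"
proof -
  have S1: "smooth_section H U Y1" and S2: "smooth_section H U Y2"
    using fr by (auto simp: orthonormal_frame_def)
  then have Y1: "smooth_vector_field U Y1" and Y2: "smooth_vector_field U Y2"
    by (auto simp: smooth_section_def)
  have sub: "U \<subseteq> topspace X" using openin_subset[OF field_openin[OF Y1]] .
  have ms: "smooth_fun U (\<lambda>r. - s r)" by (rule smooth_fun_uminus[OF s])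
  have sec: "smooth_section H U (\<lambda>r. a r *\<^sub>R Y1 r + b r *\<^sub>R Y2 r)"
    if "smooth_fun U a" "smooth_fun U b" for a b
    unfolding smooth_section_def
  proof (intro conjI ballI)
    show "smooth_vector_field U (\<lambda>r. a r *\<^sub>R Y1 r + b r *\<^sub>R Y2 r)"
      by (intro field_add field_scale Y1 Y2 that)
    fix q assume q: "q \<in> U"
    then have "Y1 q \<in> H q" "Y2 q \<in> H q" using S1 S2 by (auto simp: smooth_section_def)
    then show "a q *\<^sub>R Y1 q + b q *\<^sub>R Y2 q \<in> H q"
      using subspace_H[of q] q sub by (auto intro!: subspace_add subspace_scale)
  qed
  have fiber: "span {c q *\<^sub>R Y1 q + s q *\<^sub>R Y2 q, (- s q) *\<^sub>R Y1 q + c q *\<^sub>R Y2 q} = H q \<and>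
      g q (c q *\<^sub>R Y1 q + s q *\<^sub>R Y2 q) (c q *\<^sub>R Y1 q + s q *\<^sub>R Y2 q) = 1 \<and>
      g q ((- s q) *\<^sub>R Y1 q + c q *\<^sub>R Y2 q) ((- s q) *\<^sub>R Y1 q + c q *\<^sub>R Y2 q) = 1 \<and>
      g q (c q *\<^sub>R Y1 q + s q *\<^sub>R Y2 q) ((- s q) *\<^sub>R Y1 q + c q *\<^sub>R Y2 q) = 0"
    if q: "q \<in> U" for q
  proof -
    have H: "Y1 q \<in> H q" "Y2 q \<in> H q" using S1 S2 q by (auto simp: smooth_section_def)
    have fr_q: "span {Y1 q, Y2 q} = H q" "g q (Y1 q) (Y1 q) = 1" "g q (Y2 q) (Y2 q) = 1"
      "g q (Y1 q) (Y2 q) = 0"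
      using fr q by (auto simp: orthonormal_frame_def)
    have qX: "q \<in> topspace X" using q sub by blast
    let ?X1 = "c q *\<^sub>R Y1 q + s q *\<^sub>R Y2 q" and ?X2 = "(- s q) *\<^sub>R Y1 q + c q *\<^sub>R Y2 q"
    have "Y1 q = (c q * c q + s q * s q) *\<^sub>R Y1 q" "Y2 q = (c q * c q + s q * s q) *\<^sub>R Y2 q"
      by (simp_all add: cs[OF q])
    then have Y: "Y1 q = c q *\<^sub>R ?X1 + (- s q) *\<^sub>R ?X2" "Y2 q = s q *\<^sub>R ?X1 + c q *\<^sub>R ?X2"
      by (simp_all add: algebra_simps)
    have "{Y1 q, Y2 q} \<subseteq> span {?X1, ?X2}"
    proof -
      have "x *\<^sub>R ?X1 + y *\<^sub>R ?X2 \<in> span {?X1, ?X2}" for x y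
        by (intro span_add span_scale span_base) auto
      then show ?thesis using Y by (metis empty_subsetI insert_subset)
    qed
    moreover have "{?X1, ?X2} \<subseteq> span {Y1 q, Y2 q}"
    proof -
      have "x *\<^sub>R Y1 q + y *\<^sub>R Y2 q \<in> span {Y1 q, Y2 q}" for x y
        by (intro span_add span_scale span_base) auto
      then show ?thesis by blast
    qed
    ultimately have "span {?X1, ?X2} = span {Y1 q, Y2 q}"
      by (meson span_minimal subspace_span subset_antisym)
    then show ?thesis
      unfolding inner_combination[OF qX H] using cs[OF q] by (simp add: fr_q)
  qed
  show ?thesis
    unfolding orthonormal_frame_def using sec[OF c s] sec[OF ms c] fiber by simp
qed

lemma ex_carnot_frame:
  assumes fr: "orthonormal_frame U Y1 Y2" and p: "p \<in> U"
  shows "\<exists>X1 X2. carnot_frame U p X1 X2"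
proof -
  define Y3 where "Y3 = lie_bracket Y1 Y2"
  have Y1: "smooth_vector_field U Y1" and Y2: "smooth_vector_field U Y2"
    using fr by (auto simp: orthonormal_frame_def smooth_section_def)
  have Y3: "smooth_vector_field U Y3" unfolding Y3_def by (rule field_lie_bracket[OF Y1 Y2])
  note oU = field_openin[OF Y1]
  have sub: "U \<subseteq> topspace X" using openin_subset[OF oU] .
  have pX: "p \<in> topspace X" using p sub by blast
  have T: "tangent_space p \<subseteq> span {Y1 p, Y2 p, Y3 p}"
    unfolding Y3_def by (rule orthonormal_frame_span_tangent_space[OF fr p])
  have coeffs: "\<exists>x y z. v = x *\<^sub>R Y1 p + y *\<^sub>R Y2 p + z *\<^sub>R Y3 p" if "v \<in> tangent_space p" for v
  proof -
    have "v \<in> span {Y1 p, Y2 p, Y3 p}" using that T by blast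
    then obtain x y z where "v - x *\<^sub>R Y1 p - y *\<^sub>R Y2 p = z *\<^sub>R Y3 p"
      unfolding span_breakdown_eq span_singleton by auto
    then have "v = x *\<^sub>R Y1 p + y *\<^sub>R Y2 p + z *\<^sub>R Y3 p" by (simp add: algebra_simps)
    then show ?thesis by blast
  qed
  obtain a1 a2 a3 where a: "lie_bracket Y1 Y3 p = a1 *\<^sub>R Y1 p + a2 *\<^sub>R Y2 p + a3 *\<^sub>R Y3 p"
    using coeffs[OF lie_bracket_in_tangent_space[OF Y1 Y3 p]] by blast
  obtain b1 b2 b3 where b: "lie_bracket Y2 Y3 p = b1 *\<^sub>R Y1 p + b2 *\<^sub>R Y2 p + b3 *\<^sub>R Y3 p"
    using coeffs[OF lie_bracket_in_tangent_space[OF Y2 Y3 p]] by blast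
  obtain t where t: "smooth_fun (topspace X) t" "t p = 0"
    and jet: "Y1 p t = - b3 / 2" "Y2 p t = a3 / 2"
      "Y3 p t = (a2 - b1 + 2 * (a3 * a3 + b3 * b3)) / 6"
      "Y1 p (\<lambda>r. Y1 r t) = a1 / 2" "Y2 p (\<lambda>r. Y2 r t) = b2 / 2"
      "Y1 p (\<lambda>r. Y2 r t) + Y2 p (\<lambda>r. Y1 r t) = (a2 + b1) / 2"
    by (rule ex_function_with_2jet[OF Y1 Y2 p field_tangent[OF Y3 p] T]) (rule that)
  obtain c s where c: "smooth_fun (topspace X) c" and s: "smooth_fun (topspace X) s"
    and cs: "\<And>r. c r * c r + s r * s r = 1" and cp: "c p = 1" and sp: "s p = 0"
    and v_s: "\<And>v. v \<in> tangent_space p \<Longrightarrow> v s = 2 * v t"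
    and YZ_s: "\<And>U Y Z. smooth_vector_field U Y \<Longrightarrow> smooth_vector_field U Z \<Longrightarrow> p \<in> U \<Longrightarrow>
      Y p (\<lambda>r. Z r s) = 2 * Y p (\<lambda>r. Z r t)"
    by (rule ex_circle_functions[OF t(1) pX t(2)]) (rule that)
  note cU = smooth_fun_subset[OF c oU sub] and sU = smooth_fun_subset[OF s oU sub]
  let ?X1 = "\<lambda>r. c r *\<^sub>R Y1 r + s r *\<^sub>R Y2 r" and ?X2 = "\<lambda>r. (- s r) *\<^sub>R Y1 r + c r *\<^sub>R Y2 r"
  have "lie_bracket ?X1 (lie_bracket ?X1 ?X2) p = 0 \<and> lie_bracket ?X2 (lie_bracket ?X1 ?X2) p = 0"
    by (rule carnot_condition_of_rotation[OF Y1 Y2 cU sU cs p cp sp a[unfolded Y3_def] b[unfolded Y3_def]])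
      (use jet in \<open>simp_all add: Y3_def[symmetric] v_s[OF field_tangent[OF Y1 p]]
        v_s[OF field_tangent[OF Y2 p]] v_s[OF field_tangent[OF Y3 p]]
        YZ_s[OF Y1 Y1 p] YZ_s[OF Y1 Y2 p] YZ_s[OF Y2 Y1 p] YZ_s[OF Y2 Y2 p] field_simps\<close>)
  then have "carnot_frame U p ?X1 ?X2"
    using orthonormal_frame_rotation[OF fr cU sU cs] p by (simp add: carnot_frame_def)
  then show ?thesis by blast
qed

end

theorem theorem9:
  fixes X :: "'a topology" and A :: "('a, 3) chart set"
    and H :: "'a \<Rightarrow> 'a tvec set" and g :: "'a \<Rightarrow> 'a tvec \<Rightarrow> 'a tvec \<Rightarrow> real"
    and U :: "'a set" and p :: 'a
  assumes "sub_riemannian_2_3 X A H g"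
    and "smooth_manifold.orientable X A"
    and "openin X U"
    and "\<exists>Y1 Y2. sub_riemannian_2_3.orthonormal_frame X A H g U Y1 Y2"
    and "p \<in> U"
  shows "\<exists>X1 X2. sub_riemannian_2_3.carnot_frame X A H g U p X1 X2"
  using assms(4,5) sub_riemannian_2_3.ex_carnot_frame[OF assms(1)] by blast

end
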